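(* Let $m\geq 1$ and $n\geq 2$. Let $W\in C^1(\mathbb{R}^m;\mathbb{R})$ be nonnegative and assume: (i) there exist finitely many points $a_1,\dots,a_N\in\mathbb{R}^m$, $N\geq 1$, such that $W(a_i)=0$ for $i=1,\dots,N$ and $W(u)>0$ for all $u\in\mathbb{R}^m\setminus\{a_1,\dots,a_N\}$; (ii) there exists $r_0>0$ such that for each $i\in\{1,\dots,N\}$ and each unit vector $\nu\in\mathbb{R}^m$, $|\nu|=1$, the function $r\mapsto W(a_i+r\nu)$ is strictly increasing on $(0,r_0)$; (iii) $\liminf_{|u|\to\infty}W(u)>0$. Suppose that $u\in C^2(\mathbb{R}^n;\mathbb{R}^m)$ is a bounded, globally minimizing solution of \[ \Delta u=\nabla W(u)\quad\text{in }\mathbb{R}^n \] such that \[ \int_{\mathbb{R}^n}W(u(x))\,dx<\infty . \] Then $u\equiv a_i$ on $\mathbb{R}^n$ for some $i\in\{1,\dots,N\}$.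
   Context: A solution $u$ of $\Delta u=\nabla W(u)$ in $\mathbb{R}^n$ is called globally minimizing if for every bounded open set $\Omega\subset\mathbb{R}^n$ with Lipschitz boundary one has $E_\Omega(u)\leq E_\Omega(u+\varphi)$ for all $\varphi\in H^1_0(\Omega;\mathbb{R}^m)$ (extended by zero outside $\Omega$), where $E_\Omega(v)=\int_\Omega\left\{\frac12|\nabla v|^2+W(v)\right\}dx$. *)

theory Defs
  imports "HOL-Analysis.Analysis"
begin

definition lipschitz_boundary :: "(real^'n) set \<Rightarrow> bool" where
  "lipschitz_boundary \<Omega> \<longleftrightarrow>
     (\<forall>p \<in> frontier \<Omega>. \<exists>r>0. \<exists>(R::real^'n \<Rightarrow> real^'n) (k::'n) (\<gamma>::real^'n \<Rightarrow> real) L.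
        orthogonal_transformation R \<and>
        (\<forall>x t. \<gamma> (x + t *\<^sub>R axis k 1) = \<gamma> x) \<and>
        L-lipschitz_on UNIV \<gamma> \<and>
        \<Omega> \<inter> ball p r = {x \<in> ball p r. (R x) $ k > \<gamma> (R x)})"

definition test_fun :: "(real^'n \<Rightarrow> real) \<Rightarrow> (real^'n \<Rightarrow> ((real^'n) \<Rightarrow>\<^sub>L real)) \<Rightarrow> bool" where
  "test_fun \<psi> D\<psi> \<longleftrightarrow>
     (\<forall>x. (\<psi> has_derivative blinfun_apply (D\<psi> x)) (at x)) \<and>
     continuous_on UNIV D\<psi> \<and> compact (closure {x. \<psi> x \<noteq> 0})"

definition weak_grad :: "(real^'n \<Rightarrow> real^'m) \<Rightarrow> (real^'n \<Rightarrow> real^'m^'n) \<Rightarrow> bool" where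
  "weak_grad \<phi> G \<longleftrightarrow>
     (\<forall>\<psi> D\<psi>. test_fun \<psi> D\<psi> \<longrightarrow>
        (\<forall>j. integral\<^sup>L lborel (\<lambda>x. blinfun_apply (D\<psi> x) (axis j 1) *\<^sub>R \<phi> x)
             = - integral\<^sup>L lborel (\<lambda>x. \<psi> x *\<^sub>R (G x $ j))))"

text \<open>\<phi> belongs to H^1_0(\<Omega>) (extended by zero outside \<Omega>), with weak gradient G.\<close>
definition H10 :: "(real^'n) set \<Rightarrow> (real^'n \<Rightarrow> real^'m) \<Rightarrow> (real^'n \<Rightarrow> real^'m^'n) \<Rightarrow> bool" where
  "H10 \<Omega> \<phi> G \<longleftrightarrow>
     \<phi> \<in> borel_measurable lborel \<and> G \<in> borel_measurable lborel \<and>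
     integrable lborel (\<lambda>x. (norm (\<phi> x))\<^sup>2) \<and> integrable lborel (\<lambda>x. (norm (G x))\<^sup>2) \<and>
     (AE x in lborel. x \<notin> \<Omega> \<longrightarrow> \<phi> x = 0) \<and> weak_grad \<phi> G"

definition energy :: "(real^'m \<Rightarrow> real) \<Rightarrow> (real^'n) set \<Rightarrow> (real^'n \<Rightarrow> real^'m)
                        \<Rightarrow> (real^'n \<Rightarrow> real^'m^'n) \<Rightarrow> ennreal" where
  "energy W \<Omega> v Dv =
     (\<integral>\<^sup>+ x \<in> \<Omega>. ennreal (1/2 * (\<Sum>j\<in>UNIV. (norm (Dv x $ j))\<^sup>2) + W (v x)) \<partial>lborel)"

definition grad_mat :: "(real^'n \<Rightarrow> ((real^'n) \<Rightarrow>\<^sub>L (real^'m))) \<Rightarrow> real^'n \<Rightarrow> real^'m^'n" where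
  "grad_mat Du x = (\<chi> j. blinfun_apply (Du x) (axis j 1))"

definition globally_minimizing ::
  "(real^'m \<Rightarrow> real) \<Rightarrow> (real^'n \<Rightarrow> real^'m) \<Rightarrow> (real^'n \<Rightarrow> ((real^'n) \<Rightarrow>\<^sub>L (real^'m))) \<Rightarrow> bool" where
  "globally_minimizing W u Du \<longleftrightarrow>
     (\<forall>\<Omega> \<phi> G. bounded \<Omega> \<and> open \<Omega> \<and> lipschitz_boundary \<Omega> \<and> H10 \<Omega> \<phi> G \<longrightarrow>
        energy W \<Omega> u (grad_mat Du) \<le> energy W \<Omega> (\<lambda>x. u x + \<phi> x) (\<lambda>x. grad_mat Du x + G x))"

definition laplacian ::
  "(real^'n \<Rightarrow> ((real^'n) \<Rightarrow>\<^sub>L ((real^'n) \<Rightarrow>\<^sub>L (real^'m)))) \<Rightarrow> real^'n \<Rightarrow> real^'m" where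
  "laplacian D2u x = (\<Sum>j\<in>UNIV. blinfun_apply (blinfun_apply (D2u x) (axis j 1)) (axis j 1))"

end

theory Submission
  imports Defs
begin

text \<open>
  Since \<open>u\<close> and \<open>\<Delta>u\<close> are bounded, a barrier argument on half-balls bounds the gradient of \<open>u\<close>.
  As \<open>W(u)\<close> is integrable and \<open>u\<close> is Lipschitz, \<open>u(x)\<close> approaches the zero set of \<open>W\<close> as \<open>|x| \<rightarrow> \<infinity>\<close>,
  and since the complement of a ball is connected for \<open>n \<ge> 2\<close>, it converges to a single zero \<open>a\<close>.
  For each small \<open>s > 0\<close> there is a nonexpansive \<open>C\<^sup>1\<close> map \<open>\<Phi>\<close> that is the identity on
  \<open>{v. |v - a|\<^sup>2 \<le> s}\<close>, pulls other points radially towards \<open>a\<close>, and collapses everything at distance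
  at least \<open>r\<^sub>0\<close> to \<open>a\<close>. By monotonicity of \<open>W\<close> near \<open>a\<close>, \<open>\<Phi> \<circ> u\<close> has no more energy than \<open>u\<close>, and
  strictly less if \<open>u\<close> takes a value with \<open>s < |v - a|\<^sup>2 < r\<^sub>0\<^sup>2\<close>. It differs from \<open>u\<close> only on a bounded set, so
  minimality excludes such values, and by connectedness \<open>|u - a|\<^sup>2 \<le> s\<close> everywhere. Now let \<open>s \<rightarrow> 0\<close>.
\<close>

section \<open>Gradient bound\<close>

text \<open>At an interior maximum \<open>g' 0 = 0\<close>; if \<open>c\<close> were positive,
  \<open>g'\<close> would be positive just to the right of 0 and the mean value theorem would push
  \<open>g\<close> above \<open>g 0\<close>. The second derivative is asked for at the single point
  0, which is all that the twice differentiable \<open>u\<close> offers along a line through a given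
  point.\<close>

lemma second_deriv_nonpos_at_max:
  fixes g g' :: "real \<Rightarrow> real"
  assumes "0 < d"
    and g: "\<And>t. \<bar>t\<bar> < d \<Longrightarrow> (g has_real_derivative g' t) (at t)"
    and g2: "(g' has_real_derivative c) (at 0)"
    and le: "\<And>t. \<bar>t\<bar> < d \<Longrightarrow> g t \<le> g 0"
  shows "c \<le> 0"
proof (rule ccontr)
  assume "\<not> c \<le> 0"
  then have "0 < c" by simp
  have "g' 0 = 0"
    using DERIV_local_max[OF g[of 0] \<open>0 < d\<close>] le \<open>0 < d\<close> by (simp add: abs_minus_commute)
  obtain e where e: "0 < e" "\<And>h. 0 < h \<Longrightarrow> h < e \<Longrightarrow> 0 < g' h"
    using DERIV_pos_inc_right[OF g2 \<open>0 < c\<close>] \<open>g' 0 = 0\<close> by auto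
  define h where "h = min d e / 2"
  have h: "0 < h" "h < d" "h < e" using \<open>0 < d\<close> \<open>0 < e\<close> by (auto simp: h_def)
  obtain z where z: "0 < z" "z < h" "g h - g 0 = (h - 0) * g' z"
    using MVT2[OF \<open>0 < h\<close>, of g g'] g h by fastforce
  then have "0 < g h - g 0" using e(2)[of z] h by simp
  with le[of h] h show False by simp
qed

text \<open>The pointwise half of the maximum principle, one axis at a time. It is phrased with
  one-variable partials so that \<open>H\<close> may involve a reflected copy of \<open>u\<close>
  without assembling its Hessian.\<close>

lemma sum_second_partials_nonpos_at_max:
  fixes H :: "real^'n \<Rightarrow> real" and H' :: "'n \<Rightarrow> real^'n \<Rightarrow> real"
  assumes "open S" "x \<in> S" and max: "\<And>y. y \<in> S \<Longrightarrow> H y \<le> H x"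
    and H: "\<And>j y. ((\<lambda>t. H (y + t *\<^sub>R axis j 1)) has_real_derivative H' j y) (at 0)"
    and H': "\<And>j. ((\<lambda>t. H' j (x + t *\<^sub>R axis j 1)) has_real_derivative c j) (at 0)"
  shows "(\<Sum>j\<in>UNIV. c j) \<le> 0"
proof (rule sum_nonpos)
  fix j :: 'n
  obtain d where d: "0 < d" "ball x d \<subseteq> S"
    using \<open>open S\<close> \<open>x \<in> S\<close> open_contains_ball by blast
  \<comment> \<open>The partial derivative at the shifted base point is the derivative at time
    \<open>s\<close> along the line through \<open>x\<close>.\<close>
  have "((\<lambda>t. H (x + t *\<^sub>R axis j 1)) has_real_derivative H' j (x + s *\<^sub>R axis j 1)) (at s)" for s
    using H[where j=j and y="x + s *\<^sub>R axis j 1"] DERIV_shift[of "\<lambda>t. H (x + t *\<^sub>R axis j 1)" _ 0 s]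
    by (simp add: algebra_simps)
  moreover have "x + s *\<^sub>R axis j 1 \<in> S" if "\<bar>s\<bar> < d" for s
    using that d by (intro subsetD[OF d(2)]) (auto simp: dist_norm)
  ultimately show "c j \<le> 0"
    using second_deriv_nonpos_at_max[OF \<open>0 < d\<close> _ H'[of j],
        of "\<lambda>t. H (x + t *\<^sub>R axis j 1)"] max by simp
qed

lemma has_vector_derivative_along_line:
  assumes "(f has_derivative f') (at (q + s *\<^sub>R h))"
  shows "((\<lambda>t. f (q + t *\<^sub>R h)) has_vector_derivative f' h) (at s)"
proof -
  have "((\<lambda>t. q + t *\<^sub>R h) has_derivative (\<lambda>t. t *\<^sub>R h)) (at s)"
    by (auto intro!: derivative_eq_intros)
  then have "((f \<circ> (\<lambda>t. q + t *\<^sub>R h)) has_derivative (f' \<circ> (\<lambda>t. t *\<^sub>R h))) (at s)"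
    using assms by (rule diff_chain_at)
  then show ?thesis
    using has_derivative_linear[OF assms] by (simp add: has_vector_derivative_def o_def linear_cmul)
qed

lemma has_real_derivative_inner_along_line:
  fixes f :: "'a::real_normed_vector \<Rightarrow> 'b::real_inner"
  assumes "(f has_derivative f') (at q)"
  shows "((\<lambda>t. v \<bullet> f (q + t *\<^sub>R h)) has_real_derivative v \<bullet> f' h) (at 0)"
  using bounded_linear.has_vector_derivative[OF bounded_linear_inner_right
      has_vector_derivative_along_line[of f f' q 0 h]] assms
  by (simp add: has_real_derivative_iff_has_vector_derivative)

lemma has_real_derivative_inner_blinfun_along_line:
  fixes F :: "'a::real_normed_vector \<Rightarrow> ('b::real_normed_vector \<Rightarrow>\<^sub>L 'c::real_inner)"
  assumes "(F has_derivative F') (at q)"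
  shows "((\<lambda>t. v \<bullet> blinfun_apply (F (q + t *\<^sub>R h)) w)
    has_real_derivative v \<bullet> blinfun_apply (F' h) w) (at 0)"
proof -
  have "bounded_linear (\<lambda>A. v \<bullet> blinfun_apply A w)"
    by (intro bounded_linear_intros)
  from bounded_linear.has_vector_derivative[OF this has_vector_derivative_along_line[of F F' q 0 h]]
  show ?thesis using assms by (simp add: has_real_derivative_iff_has_vector_derivative)
qed

text \<open>The odd part of \<^term>\<open>u\<close> across the hyperplane through \<^term>\<open>p\<close> orthogonal to the
  \<^term>\<open>k\<close>-th axis vanishes on that hyperplane, so on a unit half-ball it lies below the barrier
  \<^term>\<open>2 * M * norm x ^ 2 + K * (2 * x $ k - x $ k ^ 2)\<close>, which grows linearly in \<^term>\<open>x $ k\<close>.\<close>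

lemma odd_part_le_barrier:
  fixes u :: "real^'n \<Rightarrow> real^'m"
    and Du :: "real^'n \<Rightarrow> ((real^'n) \<Rightarrow>\<^sub>L (real^'m))"
    and D2u :: "real^'n \<Rightarrow> ((real^'n) \<Rightarrow>\<^sub>L ((real^'n) \<Rightarrow>\<^sub>L (real^'m)))"
  assumes u: "\<And>x. (u has_derivative blinfun_apply (Du x)) (at x)"
    and Du: "\<And>x. (Du has_derivative blinfun_apply (D2u x)) (at x)"
    and M: "\<And>x. norm (u x) \<le> M" and F: "\<And>x. norm (laplacian D2u x) \<le> F"
    and v: "norm v = 1" and K: "K = 2 * M * CARD('n) + F + 1"
    and t: "0 \<le> t" "t \<le> 1"
  shows "v \<bullet> (u (p + t *\<^sub>R axis k 1) - u (p - t *\<^sub>R axis k 1)) \<le> (2 * M + 2 * K) * t"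
proof -
  have "0 \<le> M" using order_trans[OF norm_ge_zero M] .
  have "0 \<le> F" using order_trans[OF norm_ge_zero F] .
  have "0 \<le> K" using \<open>0 \<le> M\<close> \<open>0 \<le> F\<close> K by simp
  \<comment> \<open>\<open>\<sigma>\<close> is the reflection in the hyperplane
    \<open>x $ k = 0\<close>, and \<open>s j\<close> is its eigenvalue on the \<open>j\<close>-th
    axis.\<close>
  define \<sigma> :: "real^'n \<Rightarrow> real^'n" where "\<sigma> x = x - (2 * x $ k) *\<^sub>R axis k 1" for x
  define s :: "'n \<Rightarrow> real" where "s j = (if j = k then -1 else 1)" for j
  have \<sigma>: "\<sigma> (y + r *\<^sub>R axis j 1) = \<sigma> y + r *\<^sub>R (s j *\<^sub>R axis j 1)" for y r j
    by (auto simp: \<sigma>_def s_def vec_eq_iff axis_def)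
  \<comment> \<open>The quadratic term reaches \<open>2 * M\<close> on the unit sphere, which
    dominates the odd part there. The \<open>K\<close> term vanishes on the flat face and makes the
    Laplacian of \<open>\<psi>\<close> equal to
    \<open>4 * M * CARD('n) - 2 * K = - 2 * F - 2\<close>.\<close>
  define \<psi> where "\<psi> x = 2 * M * (x \<bullet> x) + K * (2 * x $ k - (x $ k)\<^sup>2)" for x :: "real^'n"
  define H where "H x = v \<bullet> u (p + x) - v \<bullet> u (p + \<sigma> x) - \<psi> x" for x
  define \<psi>' where "\<psi>' j x = 4 * M * x $ j + K * (2 - 2 * x $ k) * (if j = k then 1 else 0)"
    for j and x :: "real^'n"
  define H' where "H' j x = v \<bullet> Du (p + x) (axis j 1) - v \<bullet> Du (p + \<sigma> x) (s j *\<^sub>R axis j 1) - \<psi>' j x"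
    for j x
  define c where "c x j = v \<bullet> D2u (p + x) (axis j 1) (axis j 1)
      - v \<bullet> D2u (p + \<sigma> x) (s j *\<^sub>R axis j 1) (s j *\<^sub>R axis j 1)
      - (4 * M - 2 * K * (if j = k then 1 else 0))" for x j
  have \<psi>': "((\<lambda>t. \<psi> (y + t *\<^sub>R axis j 1)) has_real_derivative \<psi>' j y) (at 0)" for j y
  proof -
    define \<delta> :: real where "\<delta> = (if j = k then 1 else 0)"
    have eq: "\<psi> (y + t *\<^sub>R axis j 1) = 2 * M * (y \<bullet> y + 2 * t * y $ j + t\<^sup>2)
        + K * (2 * (y $ k + t * \<delta>) - (y $ k + t * \<delta>)\<^sup>2)" for t
    proof -
      have "(y + t *\<^sub>R axis j 1) \<bullet> (y + t *\<^sub>R axis j 1) = y \<bullet> y + 2 * t * y $ j + t\<^sup>2"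
        by (simp add: inner_add_left inner_add_right inner_axis inner_axis' power2_eq_square algebra_simps)
      moreover have "(y + t *\<^sub>R axis j 1) $ k = y $ k + t * \<delta>"
        by (simp add: axis_def \<delta>_def)
      ultimately show ?thesis by (simp only: \<psi>_def)
    qed
    show ?thesis
      unfolding \<psi>'_def \<delta>_def[symmetric] eq
      by (auto intro!: derivative_eq_intros simp: algebra_simps)
  qed
  have H': "((\<lambda>t. H (y + t *\<^sub>R axis j 1)) has_real_derivative H' j y) (at 0)" for j y
    unfolding H_def H'_def \<sigma> add.assoc[symmetric]
    by (intro DERIV_diff has_real_derivative_inner_along_line u \<psi>')
  have c: "((\<lambda>t. H' j (y + t *\<^sub>R axis j 1)) has_real_derivative c y j) (at 0)" for j y
  proof -
    have "((\<lambda>t. \<psi>' j (y + t *\<^sub>R axis j 1)) has_real_derivative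
        (4 * M - 2 * K * (if j = k then 1 else 0))) (at 0)"
      unfolding \<psi>'_def by (auto intro!: derivative_eq_intros simp: axis_def)
    then show ?thesis
      unfolding H'_def c_def \<sigma> add.assoc[symmetric]
      by (intro DERIV_diff has_real_derivative_inner_blinfun_along_line Du)
  qed
  \<comment> \<open>The sum is the Laplacian of \<open>H\<close>. The two copies of \<open>u\<close>
    contribute at least \<open>- 2 * F\<close> and the barrier contributes \<open>2 * F + 2\<close>,
    so \<open>H\<close> is strictly subharmonic.\<close>
  have sum_c: "0 < (\<Sum>j\<in>UNIV. c y j)" for y
  proof -
    \<comment> \<open>The sign \<open>s j\<close> enters twice and cancels: reflections preserve the
      Laplacian.\<close>
    have ss: "D2u z (s j *\<^sub>R axis j 1) (s j *\<^sub>R axis j 1) = D2u z (axis j 1) (axis j 1)" for z j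
      by (simp add: s_def blinfun.scaleR_right blinfun.scaleR_left blinfun.minus_right blinfun.minus_left)
    have "(\<Sum>j\<in>UNIV. c y j) = v \<bullet> laplacian D2u (p + y) - v \<bullet> laplacian D2u (p + \<sigma> y)
        - (4 * M * CARD('n) - 2 * K)"
      unfolding c_def laplacian_def ss
      by (simp add: sum_subtractf inner_sum_right sum_distrib_left[symmetric])
    moreover have "\<bar>v \<bullet> laplacian D2u z\<bar> \<le> F" for z
      using Cauchy_Schwarz_ineq2[of v "laplacian D2u z"] F[of z] v by simp
    from this[of "p + y"] this[of "p + \<sigma> y"]
    have "- 2 * F \<le> v \<bullet> laplacian D2u (p + y) - v \<bullet> laplacian D2u (p + \<sigma> y)" by linarith
    ultimately show ?thesis unfolding K by (simp add: algebra_simps)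
  qed
  define Q where "Q = cball 0 1 \<inter> {x::real^'n. 0 \<le> x $ k}"
  have "compact Q" unfolding Q_def
    by (intro compact_Int_closed compact_cball closed_Collect_le continuous_intros)
  have "continuous_on UNIV u"
    by (rule has_derivative_continuous_on) (rule u)
  then have cont: "continuous_on S (\<lambda>x. u (f x))" if "continuous_on S f" for f and S :: "(real^'n) set"
    using continuous_on_compose2[OF _ that, of UNIV u] by simp
  have "continuous_on Q H"
    unfolding H_def \<psi>_def \<sigma>_def by (intro continuous_intros cont)
  moreover have "0 \<in> Q" by (simp add: Q_def)
  ultimately obtain x where x: "x \<in> Q" "\<And>y. y \<in> Q \<Longrightarrow> H y \<le> H x"
    using continuous_attains_sup[OF \<open>compact Q\<close>] by blast
  have "H x \<le> 0"
  proof -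
    \<comment> \<open>Strict subharmonicity excludes a maximum in the open half-ball. What remains
      is the flat face, where \<open>\<sigma> x = x\<close> cancels the two copies of
      \<open>u\<close>, and the spherical cap, where the barrier dominates.\<close>
    have "\<not> (norm x < 1 \<and> 0 < x $ k)"
    proof
      assume *: "norm x < 1 \<and> 0 < x $ k"
      have "open (ball 0 1 \<inter> {x::real^'n. 0 < x $ k})"
        by (intro open_Int open_ball open_Collect_less continuous_intros)
      then have "(\<Sum>j\<in>UNIV. c x j) \<le> 0"
        by (rule sum_second_partials_nonpos_at_max[OF _ _ _ H' c])
          (use * x(2) in \<open>auto simp: Q_def\<close>)
      with sum_c[of x] show False by simp
    qed
    then consider "x $ k = 0" | "norm x = 1" "0 \<le> x $ k"
      using x(1) by (force simp: Q_def)
    then show ?thesis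
    proof cases
      case 1
      then show ?thesis using \<open>0 \<le> M\<close> by (simp add: H_def \<sigma>_def \<psi>_def)
    next
      case 2
      have "v \<bullet> u (p + x) - v \<bullet> u (p + \<sigma> x) \<le> 2 * M"
        using Cauchy_Schwarz_ineq2[of v "u (p + x)"] Cauchy_Schwarz_ineq2[of v "u (p + \<sigma> x)"]
          M[of "p + x"] M[of "p + \<sigma> x"] v by simp
      moreover have "x $ k \<le> 1" using component_le_norm_cart[of x k] 2 by simp
      then have "(x $ k)\<^sup>2 \<le> x $ k" using 2 by (simp add: power2_eq_square mult_left_le)
      then have "0 \<le> 2 * x $ k - (x $ k)\<^sup>2" using 2 by linarith
      then have "0 \<le> K * (2 * x $ k - (x $ k)\<^sup>2)" using \<open>0 \<le> K\<close> by simp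
      moreover have "x \<bullet> x = 1" using 2 by (simp add: dot_square_norm)
      ultimately show ?thesis by (simp add: H_def \<psi>_def)
    qed
  qed
  moreover have tk: "(t *\<^sub>R axis k 1 :: real^'n) $ k = t" by (simp add: axis_def)
  then have "t *\<^sub>R axis k 1 \<in> Q" using t by (simp add: Q_def norm_axis_1)
  ultimately have "H (t *\<^sub>R axis k 1) \<le> 0" using x(2) by fastforce
  moreover have "\<sigma> (t *\<^sub>R axis k 1) = - t *\<^sub>R axis k 1"
    by (auto simp: \<sigma>_def vec_eq_iff axis_def)
  moreover have "\<psi> (t *\<^sub>R axis k 1) = 2 * M * t\<^sup>2 + K * (2 * t - t\<^sup>2)"
    unfolding \<psi>_def tk by (simp add: dot_square_norm norm_axis_1 power_mult_distrib)
  ultimately have "v \<bullet> (u (p + t *\<^sub>R axis k 1) - u (p - t *\<^sub>R axis k 1))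
      \<le> 2 * M * t\<^sup>2 + K * (2 * t - t\<^sup>2)"
    by (simp add: H_def inner_diff_right)
  also have "\<dots> \<le> 2 * M * t + K * (2 * t)"
    using t \<open>0 \<le> M\<close> \<open>0 \<le> K\<close>
    by (intro add_mono mult_left_mono) (auto simp: power2_eq_square mult_left_le)
  finally show ?thesis by (simp add: algebra_simps)
qed

text \<open>The odd part of \<open>u\<close> has derivative \<open>2 * Du p (axis k 1)\<close> in
  the normal direction, so the linear barrier bound, compared at small \<open>t\<close>, controls
  every partial derivative by \<open>M + K\<close>.\<close>

lemma lipschitz_of_bounded_laplacian:
  fixes u :: "real^'n \<Rightarrow> real^'m"
    and Du :: "real^'n \<Rightarrow> ((real^'n) \<Rightarrow>\<^sub>L (real^'m))"
    and D2u :: "real^'n \<Rightarrow> ((real^'n) \<Rightarrow>\<^sub>L ((real^'n) \<Rightarrow>\<^sub>L (real^'m)))"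
  assumes u: "\<And>x. (u has_derivative blinfun_apply (Du x)) (at x)"
    and Du: "\<And>x. (Du has_derivative blinfun_apply (D2u x)) (at x)"
    and M: "\<And>x. norm (u x) \<le> M" and F: "\<And>x. norm (laplacian D2u x) \<le> F"
  obtains L where "L-lipschitz_on UNIV u"
proof -
  define K where "K = 2 * M * CARD('n) + F + 1"
  define C where "C = M + K"
  have "0 \<le> M" using order_trans[OF norm_ge_zero M] .
  have "0 \<le> F" using order_trans[OF norm_ge_zero F] .
  have "0 \<le> C" using \<open>0 \<le> M\<close> \<open>0 \<le> F\<close> by (simp add: C_def K_def)
  have part: "norm (Du p (axis k 1)) \<le> C" for p k
  proof (rule ccontr)
    assume *: "\<not> norm (Du p (axis k 1)) \<le> C"
    define w where "w = Du p (axis k 1)"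
    have "w \<noteq> 0" using * \<open>0 \<le> C\<close> by (auto simp: w_def)
    define v where "v = w /\<^sub>R norm w"
    have v: "norm v = 1" "v \<bullet> w = norm w"
      using \<open>w \<noteq> 0\<close> by (auto simp: v_def dot_square_norm power2_eq_square)
    \<comment> \<open>With \<open>v\<close> the direction of the offending partial derivative,
      \<open>f 0 = 0\<close> and \<open>f\<close> has slope \<open>2 * (norm w - C) > 0\<close> at
      0, whereas the barrier estimate gives \<open>f h \<le> 0\<close> for small positive
      \<open>h\<close>.\<close>
    define f where "f t = v \<bullet> u (p + t *\<^sub>R axis k 1) - v \<bullet> u (p + t *\<^sub>R - axis k 1) - 2 * C * t" for t
    have "(f has_real_derivative (v \<bullet> Du p (axis k 1) - v \<bullet> Du p (- axis k 1) - 2 * C)) (at 0)"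
      unfolding f_def
      by (intro DERIV_diff has_real_derivative_inner_along_line u) (auto intro!: derivative_eq_intros)
    moreover have "0 < v \<bullet> Du p (axis k 1) - v \<bullet> Du p (- axis k 1) - 2 * C"
      using * v(2) by (simp add: blinfun.minus_right w_def)
    ultimately have "\<exists>e>0. \<forall>h>0. h < e \<longrightarrow> f 0 < f (0 + h)"
      by (rule DERIV_pos_inc_right)
    then obtain e where e: "0 < e" "\<And>h. 0 < h \<Longrightarrow> h < e \<Longrightarrow> f 0 < f h" by auto
    define h where "h = min 1 e / 2"
    have "0 < h" "h < e" "h \<le> 1" using \<open>0 < e\<close> by (auto simp: h_def)
    with e(2)[of h] odd_part_le_barrier[OF u Du M F v(1) K_def, of h p k]
    show False by (simp add: f_def C_def inner_diff_right algebra_simps)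
  qed
  have "onorm (blinfun_apply (Du x)) \<le> real CARD('n) * C" for x
  proof (rule onorm_le)
    fix h :: "real^'n"
    have "Du x h = Du x (\<Sum>j\<in>UNIV. h $ j *\<^sub>R axis j 1)"
      using basis_expansion[of h] by (simp add: scalar_mult_eq_scaleR)
    also have "\<dots> = (\<Sum>j\<in>UNIV. h $ j *\<^sub>R Du x (axis j 1))"
      by (simp add: blinfun.sum_right blinfun.scaleR_right)
    also have "norm \<dots> \<le> (\<Sum>j\<in>(UNIV::'n set). norm h * C)"
      by (rule sum_norm_le) (auto intro!: mult_mono component_le_norm_cart part)
    finally show "norm (blinfun_apply (Du x) h) \<le> real CARD('n) * C * norm h" by (simp add: algebra_simps)
  qed
  then have "(real CARD('n) * C)-lipschitz_on UNIV u"
    using \<open>0 \<le> C\<close> u by (intro bounded_derivative_imp_lipschitz[where f'="\<lambda>x. blinfun_apply (Du x)"]) auto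
  with that show thesis .
qed

section \<open>Behaviour at infinity\<close>

lemma compact_positive_lower_bound:
  fixes f :: "'a::topological_space \<Rightarrow> real"
  assumes "compact S" "continuous_on S f" "\<And>x. x \<in> S \<Longrightarrow> 0 < f x"
  obtains c where "0 < c" "\<And>x. x \<in> S \<Longrightarrow> c \<le> f x"
proof (cases "S = {}")
  case True
  then show thesis using that[of 1] by simp
next
  case False
  then obtain x where "x \<in> S" "\<forall>y\<in>S. f x \<le> f y"
    using continuous_attains_inf[OF assms(1) _ assms(2)] by blast
  then show thesis using that[of "f x"] assms(3) by blast
qed

text \<open>Markov's inequality makes the superlevel set of finite measure; removing growing balls
  leaves sets decreasing to the empty set, so continuity from above applies.\<close>

lemma superlevel_set_tail_small:
  fixes f :: "'a::euclidean_space \<Rightarrow> real"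
  assumes f: "f \<in> borel_measurable borel" and fin: "(\<integral>\<^sup>+ x. ennreal (f x) \<partial>lborel) < \<infinity>"
    and c: "0 < c" and e: "0 < e"
  obtains R where "emeasure lborel ({x. c \<le> f x} - ball 0 R) < e"
proof -
  have m[measurable]: "{x. c \<le> f x} \<in> sets borel"
    using f by measurable
  have "emeasure lborel {x. c \<le> f x} = emeasure lborel {x\<in>UNIV. 1 \<le> ennreal (1 / c) * ennreal (f x)}"
  proof -
    have "1 \<le> ennreal (1 / c) * ennreal (f x) \<longleftrightarrow> c \<le> f x" for x
      using c by (subst ennreal_mult'[symmetric]) (auto simp: field_simps)
    then show ?thesis by simp
  qed
  also have "\<dots> \<le> ennreal (1 / c) * (\<integral>\<^sup>+ x. ennreal (f x) * indicator UNIV x \<partial>lborel)"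
    by (rule nn_integral_Markov_inequality) (use f in auto)
  also have "\<dots> < \<infinity>"
    using fin by (simp add: ennreal_mult_less_top)
  finally have A: "emeasure lborel {x. c \<le> f x} \<noteq> \<infinity>" by simp
  define B where "B n = {x. c \<le> f x} - ball 0 (real n)" for n :: nat
  have "(\<lambda>n. emeasure lborel (B n)) \<longlonglongrightarrow> emeasure lborel (\<Inter>n. B n)"
  proof (rule Lim_emeasure_decseq)
    show "range B \<subseteq> sets lborel" by (auto simp: B_def)
    show "decseq B" by (auto simp: B_def decseq_def)
    fix n
    have "emeasure lborel (B n) \<le> emeasure lborel {x. c \<le> f x}"
      by (rule emeasure_mono) (auto simp: B_def)
    with A show "emeasure lborel (B n) \<noteq> \<infinity>" by (auto simp: top_unique)
  qed
  moreover have "(\<Inter>n. B n) = {}"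
  proof -
    have "\<exists>n. norm x < real n" for x :: 'a by (rule reals_Archimedean2)
    then show ?thesis by (fastforce simp: B_def not_le[symmetric])
  qed
  ultimately have "(\<lambda>n. emeasure lborel (B n)) \<longlonglongrightarrow> 0" by simp
  then have "\<forall>\<^sub>F n in sequentially. emeasure lborel (B n) < e"
    using e by (rule order_tendstoD)
  then obtain n where "emeasure lborel (B n) < e"
    by (auto simp: eventually_sequentially)
  with that show thesis by (simp add: B_def)
qed

text \<open>A point whose value is far from \<open>Z\<close> carries, by uniform continuity, a ball
  of fixed radius on which \<open>W\<close> along \<open>u\<close> is bounded below. Far out, the
  corresponding superlevel set has too little measure to contain such a ball.\<close>

lemma eventually_near_zero_set:
  fixes u :: "'a::euclidean_space \<Rightarrow> 'b::euclidean_space"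
  assumes u: "uniformly_continuous_on UNIV u" and bdd: "bounded (range u)"
    and W: "continuous_on UNIV W" and pos: "\<And>v. v \<notin> Z \<Longrightarrow> 0 < W v"
    and fin: "(\<integral>\<^sup>+ x. ennreal (W (u x)) \<partial>lborel) < \<infinity>" and e: "0 < e"
  obtains R where "\<And>x. R \<le> norm x \<Longrightarrow> \<exists>a\<in>Z. dist (u x) a < e"
proof -
  obtain M where M: "\<And>x. norm (u x) \<le> M" using bdd by (auto simp: bounded_iff)
  \<comment> \<open>Compactness of these values at distance at least \<open>e / 2\<close> from
    \<open>Z\<close> yields the uniform lower bound \<open>c\<close> for \<open>W\<close>.\<close>
  define S where "S = cball 0 M \<inter> (\<Inter>a\<in>Z. {v. e / 2 \<le> dist v a})"
  have "compact S" unfolding S_def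
    by (intro compact_Int_closed compact_cball closed_INT ballI closed_Collect_le continuous_intros)
  moreover have "0 < W v" if "v \<in> S" for v
    using that e by (intro pos) (force simp: S_def)
  ultimately obtain c where c: "0 < c" "\<And>v. v \<in> S \<Longrightarrow> c \<le> W v"
    using compact_positive_lower_bound continuous_on_subset[OF W] by (metis subset_UNIV)
  obtain d where d: "0 < d" "\<And>x y. dist y x < d \<Longrightarrow> dist (u y) (u x) < e / 2"
    using u e unfolding uniformly_continuous_on_def by (metis UNIV_I half_gt_zero)
  have "continuous_on UNIV (\<lambda>x. W (u x))"
    using continuous_on_compose2[OF W uniformly_continuous_imp_continuous[OF u]] by simp
  then have "(\<lambda>x. W (u x)) \<in> borel_measurable borel" by (rule borel_measurable_continuous_onI)
  moreover have "0 < emeasure lborel (ball (0::'a) d)"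
    using d by (simp add: emeasure_ball)
  ultimately obtain R where
    R: "emeasure lborel ({x. c \<le> W (u x)} - ball 0 R) < emeasure lborel (ball (0::'a) d)"
    using superlevel_set_tail_small[OF _ fin \<open>0 < c\<close>] by blast
  show thesis
  proof (rule that, rule ccontr)
    \<comment> \<open>The extra \<open>d\<close> keeps the whole ball around \<open>x\<close>
      outside \<open>ball 0 R\<close>.\<close>
    fix x assume x: "R + d \<le> norm x" and "\<not> (\<exists>a\<in>Z. dist (u x) a < e)"
    then have far: "e \<le> dist (u x) a" if "a \<in> Z" for a
      using that by (meson not_le)
    have "ball x d \<subseteq> {x. c \<le> W (u x)} - ball 0 R"
    proof
      fix y assume "y \<in> ball x d"
      then have y: "dist y x < d" by (simp add: dist_commute)
      have "e / 2 \<le> dist (u y) a" if "a \<in> Z" for a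
        using far[OF that] d(2)[OF y] dist_triangle[of "u x" a "u y"] by (simp add: dist_commute)
      then have "u y \<in> S" using M by (simp add: S_def)
      moreover have "R \<le> norm y"
        using x y norm_triangle_ineq2[of x "x - y"] by (simp add: dist_norm norm_minus_commute)
      ultimately show "y \<in> {x. c \<le> W (u x)} - ball 0 R" using c(2) by simp
    qed
    moreover have "{x. c \<le> W (u x)} - ball 0 R \<in> sets lborel"
      using \<open>(\<lambda>x. W (u x)) \<in> borel_measurable borel\<close> by measurable
    ultimately have "emeasure lborel (ball x d) \<le> emeasure lborel ({x. c \<le> W (u x)} - ball 0 R)"
      by (rule emeasure_mono)
    with R show False using d by (simp add: emeasure_ball)
  qed
qed

lemma finite_separated:
  fixes Z :: "'a::metric_space set"
  assumes "finite Z"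
  obtains e where "0 < e" "\<And>a b. a \<in> Z \<Longrightarrow> b \<in> Z \<Longrightarrow> a \<noteq> b \<Longrightarrow> e \<le> dist a b"
proof -
  have "\<forall>a. \<exists>d>0. \<forall>b\<in>Z. b \<noteq> a \<longrightarrow> d \<le> dist a b"
    using finite_set_avoid[OF assms] by blast
  then obtain d where d: "\<And>a. 0 < d a" "\<And>a b. b \<in> Z \<Longrightarrow> b \<noteq> a \<Longrightarrow> d a \<le> dist a b"
    by metis
  define e where "e = Min (insert 1 (d ` Z))"
  have "0 < e" using assms d(1) by (simp add: e_def)
  moreover have "e \<le> d a" if "a \<in> Z" for a using assms that by (simp add: e_def)
  ultimately show thesis using that d(2) by (metis order_trans)
qed

text \<open>The balls of radius \<open>e / 2\<close> around the zeros are disjoint, and far out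
  \<open>u\<close> takes values in their union. The connected image of the exterior region therefore
  stays in one of them, which fixes the limit.\<close>

lemma tendsto_single_zero_at_infinity:
  fixes u :: "'a::euclidean_space \<Rightarrow> 'b::euclidean_space"
  assumes dim: "2 \<le> DIM('a)" and "finite Z"
    and u: "uniformly_continuous_on UNIV u" and bdd: "bounded (range u)"
    and W: "continuous_on UNIV W" and pos: "\<And>v. v \<notin> Z \<Longrightarrow> 0 < W v"
    and fin: "(\<integral>\<^sup>+ x. ennreal (W (u x)) \<partial>lborel) < \<infinity>"
  obtains a where "a \<in> Z" "(u \<longlongrightarrow> a) at_infinity"
proof -
  obtain e where e: "0 < e" "\<And>a b. a \<in> Z \<Longrightarrow> b \<in> Z \<Longrightarrow> a \<noteq> b \<Longrightarrow> e \<le> dist a b"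
    using finite_separated[OF \<open>finite Z\<close>] by blast
  note near = eventually_near_zero_set[OF u bdd W pos fin]
  obtain R where R: "\<And>x. R \<le> norm x \<Longrightarrow> \<exists>a\<in>Z. dist (u x) a < e / 2"
    using near[where e="e / 2"] e(1) by (metis half_gt_zero)
  define S where "S = - cball (0::'a) \<bar>R\<bar>"
  have SR: "\<exists>a\<in>Z. dist (u x) a < e / 2" if "x \<in> S" for x
    using that by (intro R) (simp add: S_def)
  have "connected (u ` S)"
    using dim uniformly_continuous_imp_continuous[OF u] unfolding S_def
    by (intro connected_continuous_image connected_complement_bounded_convex)
      (auto intro: continuous_on_subset)
  obtain x0 :: 'a where x0: "norm x0 = \<bar>R\<bar> + 1" using vector_choose_size[of "\<bar>R\<bar> + 1"] by auto
  then have "x0 \<in> S" by (simp add: S_def)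
  then obtain a where a: "a \<in> Z" "dist (u x0) a < e / 2" using SR by blast
  have near_a: "dist (u x) a < e / 2" if "x \<in> S" for x
  proof (rule ccontr)
    assume *: "\<not> dist (u x) a < e / 2"
    define B where "B = (\<Union>b\<in>Z - {a}. ball b (e / 2))"
    have "ball a (e / 2) \<inter> B = {}"
    proof -
      have False if "b \<in> Z" "b \<noteq> a" "dist a y < e / 2" "dist b y < e / 2" for b y
        using e(2)[of a b] a(1) that dist_triangle[of a b y] by (simp add: dist_commute)
      then show ?thesis unfolding B_def by (simp add: disjoint_iff) blast
    qed
    moreover have "u ` S \<subseteq> ball a (e / 2) \<union> B"
      using SR by (fastforce simp: B_def dist_commute)
    moreover have "ball a (e / 2) \<inter> u ` S \<noteq> {}"
      using a(2) \<open>x0 \<in> S\<close> by (force simp: dist_commute)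
    moreover have "u x \<in> B"
      using SR[OF \<open>x \<in> S\<close>] * by (fastforce simp: B_def dist_commute)
    then have "B \<inter> u ` S \<noteq> {}" using \<open>x \<in> S\<close> by blast
    moreover have "open B" by (auto simp: B_def)
    ultimately show False
      using connectedD[OF \<open>connected (u ` S)\<close>, of "ball a (e / 2)" B] by blast
  qed
  have "(u \<longlongrightarrow> a) at_infinity"
  proof (rule tendstoI)
    fix d :: real assume "0 < d"
    \<comment> \<open>Capping at \<open>e / 2\<close> forces the zero within \<open>d'\<close> of
      \<open>u x\<close> to be \<open>a\<close>, since two distinct zeros are at least
      \<open>e\<close> apart.\<close>
    define d' where "d' = min d (e / 2)"
    have "0 < d'" using \<open>0 < d\<close> e(1) by (simp add: d'_def)
    then obtain R' where R': "\<And>x. R' \<le> norm x \<Longrightarrow> \<exists>a\<in>Z. dist (u x) a < d'"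
      using near by blast
    have "dist (u x) a < d" if x: "max R' (\<bar>R\<bar> + 1) \<le> norm x" for x
    proof -
      obtain b where b: "b \<in> Z" "dist (u x) b < d'" using R'[of x] x by auto
      have "dist (u x) a < e / 2" using x by (intro near_a) (simp add: S_def)
      then have "dist a b < e"
        using b(2) dist_triangle[of a b "u x"] by (simp add: d'_def dist_commute)
      then have "a = b" using e(2)[OF a(1) b(1)] by force
      with b(2) show ?thesis by (simp add: d'_def)
    qed
    then show "\<forall>\<^sub>F x in at_infinity. dist (u x) a < d"
      unfolding eventually_at_infinity by blast
  qed
  with a(1) that show thesis by blast
qed

section \<open>Admissible perturbations\<close>

lemma integrable_continuous_compact_support:
  fixes f :: "'a::euclidean_space \<Rightarrow> 'b::{banach, second_countable_topology}"
  assumes "continuous_on UNIV f" "compact K" "\<And>x. x \<notin> K \<Longrightarrow> f x = 0"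
  shows "integrable lborel f"
proof -
  have "integrable lborel (\<lambda>x. indicator K x *\<^sub>R f x)"
    using assms(1,2) by (intro borel_integrable_compact) (auto intro: continuous_on_subset)
  also have "(\<lambda>x. indicator K x *\<^sub>R f x) = f"
    using assms(3) by (auto simp: indicator_def)
  finally show ?thesis .
qed

lemma derivative_zero_outside_support:
  assumes f: "(f has_derivative f') (at x)" and "closed K" and 0: "\<And>x. x \<notin> K \<Longrightarrow> f x = 0"
    and "x \<notin> K"
  shows "f' h = 0"
proof -
  have "((\<lambda>_. 0) has_derivative f') (at x)"
    by (rule has_derivative_transform_within_open[OF f, of "- K"]) (use assms in auto)
  then have "f' = (\<lambda>_. 0)" by (rule has_derivative_unique) simp
  then show ?thesis by simp
qed

text \<open>Translation invariance makes the integral of every difference quotient vanish.\<close>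

lemma integral_directional_derivative_eq_0:
  fixes f :: "'a::euclidean_space \<Rightarrow> 'b::euclidean_space"
  assumes f: "\<And>x. (f has_derivative f' x) (at x)"
    and f': "continuous_on UNIV (\<lambda>x. f' x h)"
    and K: "compact K" "\<And>x. x \<notin> K \<Longrightarrow> f x = 0"
  shows "(\<integral>x. f' x h \<partial>lborel) = 0"
proof -
  have contf: "continuous_on UNIV f"
    by (rule has_derivative_continuous_on) (rule f)
  note [measurable] = borel_measurable_continuous_onI[OF contf] borel_measurable_continuous_onI[OF f']
  have f'0: "f' x h = 0" if "x \<notin> K" for x
    using derivative_zero_outside_support[OF f compact_imp_closed[OF K(1)] K(2) that] by simp
  have intf: "integrable lborel f"
    using integrable_continuous_compact_support[OF contf K] .
  obtain B where B: "\<And>x. norm (f' x h) \<le> B"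
  proof -
    have "compact ((\<lambda>x. f' x h) ` K)"
      using K(1) f' by (intro compact_continuous_image) (auto intro: continuous_on_subset)
    then obtain B where "\<And>x. x \<in> K \<Longrightarrow> norm (f' x h) \<le> B"
      by (meson bounded_iff compact_imp_bounded imageI)
    then have "norm (f' x h) \<le> max 0 B" for x using f'0[of x] by (cases "x \<in> K") force+
    then show thesis by (rule that)
  qed
  obtain r where r: "\<And>x. x \<in> K \<Longrightarrow> norm x \<le> r"
    using compact_imp_bounded[OF K(1)] by (auto simp: bounded_iff)
  define t where "t n = inverse (real (Suc n))" for n
  have t: "0 < t n" "t n \<le> 1" for n
    by (auto simp: t_def field_simps)
  define q where "q n x = (f (t n *\<^sub>R h + x) - f x) /\<^sub>R t n" for n x
  have line: "((\<lambda>s. f (x + s *\<^sub>R h)) has_vector_derivative f' (x + s *\<^sub>R h) h) (at s)" for x s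
    by (intro has_vector_derivative_along_line f)
  \<comment> \<open>Dominated convergence: the mean value inequality bounds the quotients by
    \<open>B\<close>, and as \<open>t n \<le> 1\<close> they all vanish outside
    \<open>cball 0 (r + norm h)\<close>.\<close>
  have "(\<lambda>n. \<integral>x. q n x \<partial>lborel) \<longlonglongrightarrow> (\<integral>x. f' x h \<partial>lborel)"
  proof (rule integral_dominated_convergence)
    show "integrable lborel (\<lambda>x. B * indicator (cball 0 (r + norm h)) x :: real)"
      by (intro integrable_mult_right integrable_real_indicator) (use emeasure_bounded_finite[OF bounded_cball] in auto)
    show "AE x in lborel. (\<lambda>n. q n x) \<longlonglongrightarrow> f' x h"
    proof (rule AE_I2)
      fix x
      have "((\<lambda>s. (f (x + s *\<^sub>R h) - f x) /\<^sub>R s) \<longlongrightarrow> f' x h) (at 0)"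
      proof -
        have "((\<lambda>s. norm (f (x + s *\<^sub>R h) - f x - s *\<^sub>R f' x h) / norm s) \<longlongrightarrow> 0) (at 0)"
          using line[of x 0] by (simp add: has_vector_derivative_def has_derivative_at)
        moreover have "norm (f (x + s *\<^sub>R h) - f x - s *\<^sub>R f' x h) / norm s
            = norm ((f (x + s *\<^sub>R h) - f x) /\<^sub>R s - f' x h)" if "s \<noteq> 0" for s
        proof -
          have "(f (x + s *\<^sub>R h) - f x) /\<^sub>R s - f' x h = (f (x + s *\<^sub>R h) - f x - s *\<^sub>R f' x h) /\<^sub>R s"
            using that by (simp add: scaleR_diff_right)
          then show ?thesis by (simp add: divide_inverse mult.commute)
        qed
        then have "\<forall>\<^sub>F s in at 0. norm (f (x + s *\<^sub>R h) - f x - s *\<^sub>R f' x h) / norm s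
            = norm ((f (x + s *\<^sub>R h) - f x) /\<^sub>R s - f' x h)"
          by (auto simp: eventually_at intro!: exI[of _ 1])
        ultimately have "((\<lambda>s. norm ((f (x + s *\<^sub>R h) - f x) /\<^sub>R s - f' x h)) \<longlongrightarrow> 0) (at 0)"
          by (rule Lim_transform_eventually)
        then show ?thesis
          by (rule LIM_zero_cancel[OF tendsto_norm_zero_cancel])
      qed
      moreover have "filterlim t (at 0) sequentially"
      proof -
        have "t \<longlonglongrightarrow> 0" using LIMSEQ_inverse_real_of_nat by (simp add: t_def[abs_def])
        moreover have "t n \<noteq> 0" for n using t(1)[of n] by simp
        ultimately show ?thesis by (simp add: filterlim_at)
      qed
      ultimately have "(\<lambda>n. (f (x + t n *\<^sub>R h) - f x) /\<^sub>R t n) \<longlonglongrightarrow> f' x h"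
        by (rule filterlim_compose)
      then show "(\<lambda>n. q n x) \<longlonglongrightarrow> f' x h"
        by (simp only: q_def add.commute)
    qed
    show "AE x in lborel. norm (q n x) \<le> B * indicator (cball 0 (r + norm h)) x" for n
    proof (rule AE_I2)
      fix x
      show "norm (q n x) \<le> B * indicator (cball 0 (r + norm h)) x"
      proof (cases "norm x \<le> r + norm h")
        case True
        have "norm (f (x + t n *\<^sub>R h) - f (x + 0 *\<^sub>R h)) \<le> B * norm (t n - 0)"
        proof (rule differentiable_bound[where S=UNIV and f="\<lambda>s. f (x + s *\<^sub>R h)"
              and f'="\<lambda>s r. r *\<^sub>R f' (x + s *\<^sub>R h) h"])
          show "((\<lambda>s. f (x + s *\<^sub>R h)) has_derivative (\<lambda>r. r *\<^sub>R f' (x + s *\<^sub>R h) h)) (at s within UNIV)" for s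
            using line[of x s] by (simp add: has_vector_derivative_def)
          show "onorm (\<lambda>r. r *\<^sub>R f' (x + s *\<^sub>R h) h) \<le> B" for s
          proof (rule onorm_le)
            show "norm (r *\<^sub>R f' (x + s *\<^sub>R h) h) \<le> B * norm r" for r :: real
              using mult_left_mono[OF B[of "x + s *\<^sub>R h"], of "\<bar>r\<bar>"] by (simp add: mult.commute)
          qed
        qed auto
        then have "norm (f (t n *\<^sub>R h + x) - f x) \<le> B * t n"
          using t(1)[of n] by (simp add: add.commute)
        moreover have "norm (q n x) = norm (f (t n *\<^sub>R h + x) - f x) / t n"
          using t(1)[of n] by (simp add: q_def divide_inverse mult.commute)
        ultimately have "norm (q n x) \<le> B"
          using t(1)[of n] by (simp add: divide_le_eq)
        with True show ?thesis by simp
      next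
        case False
        have "norm (t n *\<^sub>R h) \<le> norm h" using t[of n] by (simp add: mult_left_le_one_le)
        moreover have "norm x \<le> norm (t n *\<^sub>R h + x) + norm (t n *\<^sub>R h)"
          using norm_triangle_ineq4[of "t n *\<^sub>R h + x" "t n *\<^sub>R h"] by simp
        ultimately have "r < norm (t n *\<^sub>R h + x)" using False by linarith
        moreover have "r < norm x" using False norm_ge_zero[of h] by linarith
        ultimately have "x \<notin> K" "t n *\<^sub>R h + x \<notin> K"
          using r[of x] r[of "t n *\<^sub>R h + x"] by fastforce+
        then show ?thesis using False by (simp add: q_def K(2))
      qed
    qed
  qed (unfold q_def, measurable)
  moreover have "(\<integral>x. q n x \<partial>lborel) = 0" for n
  proof -
    have "(\<integral>x. f (t n *\<^sub>R h + x) \<partial>lborel) = (\<integral>x. f x \<partial>distr lborel borel ((+) (t n *\<^sub>R h)))"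
      by (rule integral_distr[symmetric]) simp_all
    then have eq: "(\<integral>x. f (t n *\<^sub>R h + x) \<partial>lborel) = (\<integral>x. f x \<partial>lborel)"
      by (simp add: lborel_distr_plus)
    have "integrable (distr lborel borel ((+) (t n *\<^sub>R h))) f"
      using intf by (simp add: lborel_distr_plus)
    then have "integrable lborel (\<lambda>x. f (t n *\<^sub>R h + x))"
      by (subst (asm) integrable_distr_eq) simp_all
    then show ?thesis
      unfolding q_def using intf eq by simp
  qed
  ultimately show ?thesis by (simp add: LIMSEQ_const_iff)
qed

text \<open>Integration by parts: the product of the test function and \<open>\<phi>\<close> has
  compact support, so its \<open>j\<close>-th partial derivative integrates to zero, and the product
  rule splits that integral.\<close>

lemma weak_grad_of_C1:
  fixes \<phi> :: "real^'n \<Rightarrow> real^'m"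
  assumes \<phi>: "\<And>x. (\<phi> has_derivative \<phi>' x) (at x)"
    and G: "\<And>x j. G x $ j = \<phi>' x (axis j 1)" and cont: "continuous_on UNIV G"
  shows "weak_grad \<phi> G"
  unfolding weak_grad_def
proof (intro allI impI)
  fix \<psi> :: "real^'n \<Rightarrow> real" and D\<psi> and j :: 'n assume "test_fun \<psi> D\<psi>"
  then have \<psi>: "\<And>x. (\<psi> has_derivative blinfun_apply (D\<psi> x)) (at x)"
    and D\<psi>: "continuous_on UNIV D\<psi>" and K: "compact (closure {x. \<psi> x \<noteq> 0})"
    by (auto simp: test_fun_def)
  define K where "K = closure {x. \<psi> x \<noteq> 0}"
  have \<psi>0: "\<psi> x = 0" if "x \<notin> K" for x
    using that closure_subset[of "{x. \<psi> x \<noteq> 0}"] by (auto simp: K_def)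
  have D\<psi>0: "D\<psi> x h = 0" if "x \<notin> K" for x h
    using derivative_zero_outside_support[OF \<psi> _ \<psi>0 that] by (simp add: K_def)
  have c\<phi>: "continuous_on UNIV \<phi>"
    by (rule has_derivative_continuous_on) (rule \<phi>)
  have c\<psi>: "continuous_on UNIV \<psi>"
    by (rule has_derivative_continuous_on) (rule \<psi>)
  have c1: "continuous_on UNIV (\<lambda>x. D\<psi> x (axis j 1) *\<^sub>R \<phi> x)"
    by (intro continuous_intros D\<psi> c\<phi>)
  have c2: "continuous_on UNIV (\<lambda>x. \<psi> x *\<^sub>R (G x $ j))"
    by (intro continuous_intros c\<psi> cont)
  have i1: "integrable lborel (\<lambda>x. D\<psi> x (axis j 1) *\<^sub>R \<phi> x)"
    by (rule integrable_continuous_compact_support[OF c1 K]) (simp add: D\<psi>0 flip: K_def)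
  have i2: "integrable lborel (\<lambda>x. \<psi> x *\<^sub>R (G x $ j))"
    by (rule integrable_continuous_compact_support[OF c2 K]) (simp add: \<psi>0 flip: K_def)
  have "(\<integral>x. (\<psi> x *\<^sub>R \<phi>' x (axis j 1) + D\<psi> x (axis j 1) *\<^sub>R \<phi> x) \<partial>lborel) = 0"
  proof (rule integral_directional_derivative_eq_0
      [where f="\<lambda>x. \<psi> x *\<^sub>R \<phi> x" and f'="\<lambda>x h. \<psi> x *\<^sub>R \<phi>' x h + D\<psi> x h *\<^sub>R \<phi> x"])
    show "((\<lambda>x. \<psi> x *\<^sub>R \<phi> x) has_derivative (\<lambda>h. \<psi> x *\<^sub>R \<phi>' x h + D\<psi> x h *\<^sub>R \<phi> x)) (at x)" for x
      by (intro has_derivative_scaleR \<psi> \<phi>)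
    show "continuous_on UNIV (\<lambda>x. \<psi> x *\<^sub>R \<phi>' x (axis j 1) + D\<psi> x (axis j 1) *\<^sub>R \<phi> x)"
      using c1 c2 by (simp add: G continuous_on_add)
    show "compact K" using K by (simp add: K_def)
    show "\<psi> x *\<^sub>R \<phi> x = 0" if "x \<notin> K" for x using \<psi>0[OF that] by simp
  qed
  then have "(\<integral>x. \<psi> x *\<^sub>R (G x $ j) \<partial>lborel) + (\<integral>x. D\<psi> x (axis j 1) *\<^sub>R \<phi> x \<partial>lborel) = 0"
    unfolding G[symmetric] Bochner_Integration.integral_add[OF i2 i1] .
  then show "(\<integral>x. D\<psi> x (axis j 1) *\<^sub>R \<phi> x \<partial>lborel) = - (\<integral>x. \<psi> x *\<^sub>R (G x $ j) \<partial>lborel)"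
    by (simp only: add_eq_0_iff)
qed

text \<open>Off \<open>closure \<Omega>\<close>, an open set, \<open>\<phi>\<close> vanishes
  identically and so does its gradient. Continuity and compact support then give square
  integrability.\<close>

lemma H10_of_C1:
  fixes \<phi> :: "real^'n \<Rightarrow> real^'m"
  assumes \<phi>: "\<And>x. (\<phi> has_derivative \<phi>' x) (at x)"
    and G: "\<And>x j. G x $ j = \<phi>' x (axis j 1)" and cont: "continuous_on UNIV G"
    and "bounded \<Omega>" and 0: "\<And>x. x \<notin> \<Omega> \<Longrightarrow> \<phi> x = 0"
  shows "H10 \<Omega> \<phi> G"
proof -
  have K: "compact (closure \<Omega>)" using \<open>bounded \<Omega>\<close> by simp
  have \<phi>0: "\<phi> x = 0" if "x \<notin> closure \<Omega>" for x using 0 that closure_subset by blast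
  then have G0: "G x = 0" if "x \<notin> closure \<Omega>" for x
    using derivative_zero_outside_support[OF \<phi> _ _ that] by (simp add: vec_eq_iff G)
  have c\<phi>: "continuous_on UNIV \<phi>"
    by (rule has_derivative_continuous_on) (rule \<phi>)
  have "integrable lborel (\<lambda>x. (norm (\<phi> x))\<^sup>2)"
    by (rule integrable_continuous_compact_support[OF _ K]) (auto intro!: continuous_intros c\<phi> simp: \<phi>0)
  moreover have "integrable lborel (\<lambda>x. (norm (G x))\<^sup>2)"
    by (rule integrable_continuous_compact_support[OF _ K]) (auto intro!: continuous_intros cont simp: G0)
  ultimately show ?thesis
    using weak_grad_of_C1[OF \<phi> G cont] 0
      borel_measurable_continuous_onI[OF c\<phi>] borel_measurable_continuous_onI[OF cont]
    by (simp add: H10_def)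
qed

text \<open>The open \<open>l1\<close> ball. It exhausts the space, and unlike a round ball it has
  boundary graphs given by one globally Lipschitz formula, as \<open>lipschitz_boundary\<close>
  demands.\<close>

definition cross_polytope :: "real \<Rightarrow> (real^'n) set" where
  "cross_polytope R = {x. (\<Sum>i\<in>UNIV. \<bar>x $ i\<bar>) < R}"

lemma open_cross_polytope: "open (cross_polytope R)"
  unfolding cross_polytope_def by (intro open_Collect_less continuous_intros)

lemma bounded_cross_polytope: "bounded (cross_polytope R)"
  unfolding bounded_iff cross_polytope_def
  by (intro exI[of _ R]) (auto intro: order_trans[OF norm_le_l1_cart])

lemma norm_ge_outside_cross_polytope:
  fixes x :: "real^'n"
  assumes "x \<notin> cross_polytope (real CARD('n) * R)"
  shows "R \<le> norm x"
proof -
  have "real CARD('n) * R \<le> (\<Sum>i\<in>UNIV. \<bar>x $ i\<bar>)" using assms by (simp add: cross_polytope_def)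
  also have "\<dots> \<le> (\<Sum>i\<in>(UNIV::'n set). norm x)" by (intro sum_mono component_le_norm_cart)
  finally show ?thesis by simp
qed

text \<open>Near a boundary point with \<^term>\<open>p $ k \<noteq> 0\<close> the sign of the \<^term>\<open>k\<close>-th coordinate is constant,
  so the boundary is a graph over the other coordinates, up to the reflection \<^term>\<open>uminus\<close>.\<close>

lemma lipschitz_boundary_cross_polytope:
  assumes "0 < R"
  shows "lipschitz_boundary (cross_polytope R :: (real^'n) set)"
  unfolding lipschitz_boundary_def
proof
  fix p :: "real^'n" assume p: "p \<in> frontier (cross_polytope R)"
  have "p \<notin> cross_polytope R"
    using p by (simp add: frontier_def interior_open[OF open_cross_polytope])
  then have "p \<noteq> 0" using \<open>0 < R\<close> by (auto simp: cross_polytope_def)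
  then obtain k where k: "p $ k \<noteq> 0" by (auto simp: vec_eq_iff)
  \<comment> \<open>The minus sign turns \<open>\<bar>x $ k\<bar>\<close> into
    \<open>- \<epsilon> * x $ k\<close> near \<open>p\<close>, so that the polytope lies above the
    graph, as in \<open>lipschitz_boundary\<close>.\<close>
  define \<epsilon> :: real where "\<epsilon> = - sgn (p $ k)"
  have \<epsilon>: "\<epsilon> = 1 \<or> \<epsilon> = -1" using k by (auto simp: \<epsilon>_def sgn_if)
  define \<gamma> where "\<gamma> x = (\<Sum>i\<in>UNIV - {k}. \<bar>x $ i\<bar>) - R" for x :: "real^'n"
  have "orthogonal_transformation (\<lambda>x::real^'n. \<epsilon> *\<^sub>R x)"
    using \<epsilon> by (auto simp: orthogonal_transformation_def linear_iff algebra_simps)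
  moreover have "\<gamma> (x + t *\<^sub>R axis k 1) = \<gamma> x" for x t
    by (auto simp: \<gamma>_def axis_def intro!: sum.cong)
  moreover have "(real CARD('n))-lipschitz_on UNIV \<gamma>"
  proof (rule lipschitz_onI)
    fix x y :: "real^'n"
    have "dist (\<gamma> x) (\<gamma> y) = \<bar>\<Sum>i\<in>UNIV - {k}. \<bar>x $ i\<bar> - \<bar>y $ i\<bar>\<bar>"
      by (simp add: \<gamma>_def dist_real_def sum_subtractf)
    also have "\<dots> \<le> (\<Sum>i\<in>UNIV - {k}. norm (x - y))"
      by (intro order_trans[OF sum_abs] sum_mono)
        (metis abs_triangle_ineq3 component_le_norm_cart order_trans vector_minus_component)
    also have "\<dots> \<le> real CARD('n) * dist x y"
      by (simp add: dist_norm mult_right_mono)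
    finally show "dist (\<gamma> x) (\<gamma> y) \<le> real CARD('n) * dist x y" .
  qed simp
  moreover have "cross_polytope R \<inter> ball p \<bar>p $ k\<bar>
      = {x \<in> ball p \<bar>p $ k\<bar>. (\<epsilon> *\<^sub>R x) $ k > \<gamma> (\<epsilon> *\<^sub>R x)}"
  proof -
    have "x \<in> cross_polytope R \<longleftrightarrow> (\<epsilon> *\<^sub>R x) $ k > \<gamma> (\<epsilon> *\<^sub>R x)" if "x \<in> ball p \<bar>p $ k\<bar>" for x
    proof -
      have "\<bar>p $ k - x $ k\<bar> < \<bar>p $ k\<bar>"
        using that component_le_norm_cart[of "p - x" k] by (simp add: dist_norm)
      then have "\<bar>x $ k\<bar> = - \<epsilon> * x $ k" using k by (auto simp: \<epsilon>_def sgn_if split: if_splits)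
      moreover have "\<gamma> (\<epsilon> *\<^sub>R x) = \<gamma> x" using \<epsilon> by (auto simp: \<gamma>_def)
      moreover have "(\<Sum>i\<in>UNIV. \<bar>x $ i\<bar>) = \<bar>x $ k\<bar> + (\<Sum>i\<in>UNIV - {k}. \<bar>x $ i\<bar>)"
        by (rule sum.remove) auto
      ultimately show ?thesis by (auto simp: cross_polytope_def \<gamma>_def)
    qed
    then show ?thesis by blast
  qed
  ultimately show "\<exists>r>0. \<exists>(R'::real^'n \<Rightarrow> real^'n) (k::'n) (\<gamma>::real^'n \<Rightarrow> real) L.
        orthogonal_transformation R' \<and> (\<forall>x t. \<gamma> (x + t *\<^sub>R axis k 1) = \<gamma> x) \<and>
        L-lipschitz_on UNIV \<gamma> \<and>
        cross_polytope R \<inter> ball p r = {x \<in> ball p r. (R' x) $ k > \<gamma> (R' x)}"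
    using k by (intro exI[of _ "\<bar>p $ k\<bar>"] conjI exI[of _ "\<lambda>x. \<epsilon> *\<^sub>R x"] exI[of _ k] exI[of _ \<gamma>]
        exI[of _ "real CARD('n)"]) auto
qed

text \<open>This turns minimality of the energy into a pointwise identity of densities. Boundedness
  of \<open>\<Omega>\<close> makes both integrals finite, so they can be subtracted.\<close>

lemma eq_of_set_nn_integral_le:
  fixes f g :: "'a::euclidean_space \<Rightarrow> real"
  assumes f: "continuous_on UNIV f" and g: "continuous_on UNIV g"
    and \<Omega>: "open \<Omega>" "bounded \<Omega>"
    and g0: "\<And>x. 0 \<le> g x" and gf: "\<And>x. g x \<le> f x"
    and le: "(\<integral>\<^sup>+x\<in>\<Omega>. ennreal (f x) \<partial>lborel) \<le> (\<integral>\<^sup>+x\<in>\<Omega>. ennreal (g x) \<partial>lborel)"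
    and x: "x \<in> \<Omega>"
  shows "f x = g x"
proof -
  have int: "integrable lborel (\<lambda>x. indicator \<Omega> x *\<^sub>R h x)" if "continuous_on UNIV h" for h :: "'a \<Rightarrow> real"
  proof -
    have "integrable lborel (\<lambda>x. indicator (closure \<Omega>) x *\<^sub>R h x)"
      using \<Omega> that by (intro borel_integrable_compact) (auto intro: continuous_on_subset)
    then have "integrable lborel (\<lambda>x. indicator \<Omega> x *\<^sub>R (indicator (closure \<Omega>) x *\<^sub>R h x))"
      using \<Omega>(1) by (intro integrable_mult_indicator[of \<Omega>]) simp_all
    also have "(\<lambda>x. indicator \<Omega> x *\<^sub>R (indicator (closure \<Omega>) x *\<^sub>R h x)) = (\<lambda>x. indicator \<Omega> x *\<^sub>R h x)"
      using closure_subset by (fastforce simp: indicator_def)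
    finally show ?thesis .
  qed
  have nn: "(\<integral>\<^sup>+x\<in>\<Omega>. ennreal (h x) \<partial>lborel) = ennreal (\<integral>x. indicator \<Omega> x *\<^sub>R h x \<partial>lborel)"
    if "continuous_on UNIV h" "\<And>x. 0 \<le> h x" for h :: "'a \<Rightarrow> real"
  proof -
    have "(\<integral>\<^sup>+x\<in>\<Omega>. ennreal (h x) \<partial>lborel) = (\<integral>\<^sup>+x. ennreal (indicator \<Omega> x *\<^sub>R h x) \<partial>lborel)"
      by (intro nn_integral_cong) (auto simp: indicator_def)
    also have "\<dots> = ennreal (\<integral>x. indicator \<Omega> x *\<^sub>R h x \<partial>lborel)"
      using that by (intro nn_integral_eq_integral int) auto
    finally show ?thesis .
  qed
  have f0: "0 \<le> f x" for x using g0 gf order_trans by blast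
  have "0 \<le> (\<integral>x. indicator \<Omega> x *\<^sub>R g x \<partial>lborel)"
    by (rule integral_nonneg_AE) (simp add: g0)
  then have "(\<integral>x. indicator \<Omega> x *\<^sub>R f x \<partial>lborel) \<le> (\<integral>x. indicator \<Omega> x *\<^sub>R g x \<partial>lborel)"
    using le unfolding nn[OF f f0] nn[OF g g0] by simp
  moreover have fg: "continuous_on UNIV (\<lambda>x. f x - g x)" using f g by (intro continuous_intros)
  have "(\<integral>x. indicator \<Omega> x *\<^sub>R (f x - g x) \<partial>lborel)
      = (\<integral>x. indicator \<Omega> x *\<^sub>R f x \<partial>lborel) - (\<integral>x. indicator \<Omega> x *\<^sub>R g x \<partial>lborel)"
    unfolding scaleR_diff_right by (rule Bochner_Integration.integral_diff[OF int[OF f] int[OF g]])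
  moreover have "0 \<le> (\<integral>x. indicator \<Omega> x *\<^sub>R (f x - g x) \<partial>lborel)"
    by (rule integral_nonneg_AE) (simp add: gf)
  ultimately have "(\<integral>x. indicator \<Omega> x *\<^sub>R (f x - g x) \<partial>lborel) = 0" by linarith
  then have AE0: "AE x in lborel. indicator \<Omega> x *\<^sub>R (f x - g x) = 0"
    by (subst (asm) integral_nonneg_eq_0_iff_AE[OF int[OF fg]]) (simp_all add: gf)
  \<comment> \<open>The densities agree almost everywhere; \<open>S\<close> is open and null, hence
    contains no ball.\<close>
  define S where "S = \<Omega> \<inter> {x. g x < f x}"
  have "open S"
    unfolding S_def using \<Omega>(1) f g by (intro open_Int open_Collect_less) auto
  have "S \<in> null_sets lborel"
  proof (rule AE_iff_null_sets[THEN iffD2])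
    show "S \<in> sets lborel" using \<open>open S\<close> by simp
    show "AE x in lborel. x \<notin> S" using AE0 by eventually_elim (auto simp: S_def)
  qed
  show ?thesis
  proof (rule ccontr)
    assume "f x \<noteq> g x"
    then have "x \<in> S" using gf[of x] x by (simp add: S_def)
    then obtain d where d: "0 < d" "ball x d \<subseteq> S" using \<open>open S\<close> open_contains_ball by blast
    have "ball x d \<in> null_sets lborel"
      by (rule null_sets_subset[OF \<open>S \<in> null_sets lborel\<close> _ d(2)]) simp
    then have "emeasure lborel (ball x d) = 0" by (rule null_setsD1)
    with d(1) show False using unit_ball_vol_pos[of "real DIM('a)"] by (simp add: emeasure_ball)
  qed
qed

section \<open>The radial cutoff\<close>

text \<open>Squaring removes the corner of the positive part, so that gluing with a constant stays
  C1.\<close>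

definition sq_pos :: "real \<Rightarrow> real" where
  "sq_pos x = (max 0 x)\<^sup>2"

lemma has_real_derivative_sq_pos: "(sq_pos has_real_derivative 2 * max 0 x) (at x)"
proof -
  consider "x < 0" | "x = 0" | "0 < x" by linarith
  then show ?thesis
  proof cases
    case 1
    have "((\<lambda>_. 0) has_real_derivative 0) (at x)" by simp
    then have "(sq_pos has_real_derivative 0) (at x)"
      by (rule has_field_derivative_transform_within_open[where S="{..<0}"])
        (use 1 in \<open>auto simp: sq_pos_def\<close>)
    with 1 show ?thesis by simp
  next
    case 2
    have "((\<lambda>h. max 0 h) \<longlongrightarrow> max 0 (0::real)) (at 0)" by (intro tendsto_intros)
    moreover have "(\<lambda>h. (sq_pos (0 + h) - sq_pos 0) / h) = (\<lambda>h. max 0 h)"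
      by (auto simp: sq_pos_def max_def power2_eq_square)
    ultimately show ?thesis using 2 by (simp add: DERIV_def)
  next
    case 3
    have "((\<lambda>x. x\<^sup>2) has_real_derivative 2 * x) (at x)" by (auto intro!: derivative_eq_intros)
    then have "(sq_pos has_real_derivative 2 * x) (at x)"
      by (rule has_field_derivative_transform_within_open[where S="{0<..}"])
        (use 3 in \<open>auto simp: sq_pos_def\<close>)
    with 3 show ?thesis by simp
  qed
qed

lemma continuous_on_sq_pos [continuous_intros]:
  "continuous_on S f \<Longrightarrow> continuous_on S (\<lambda>x. sq_pos (f x))"
  unfolding sq_pos_def by (intro continuous_intros)

text \<open>A \<open>C\<^sup>1\<close> cutoff from 1 on \<open>[0, 1]\<close> down to 0 on \<open>[2 exp 8, \<infinity>)\<close>. It is a function of \<open>ln (1 + t)\<close>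
  varying slowly enough that \<open>\<bar>t * cutoff' t\<bar> \<le> 1/2\<close>, which makes \<open>radial_cut\<close> below nonexpansive.\<close>

definition cutoff :: "real \<Rightarrow> real" where
  "cutoff t = sq_pos (1 - sq_pos (ln (1 + t) - ln 2) / 64)"

definition cutoff' :: "real \<Rightarrow> real" where
  "cutoff' t = - (max 0 (1 - sq_pos (ln (1 + t) - ln 2) / 64) * max 0 (ln (1 + t) - ln 2) / (16 * (1 + t)))"

lemma has_real_derivative_cutoff:
  assumes "0 \<le> t"
  shows "(cutoff has_real_derivative cutoff' t) (at t)"
proof -
  have 1: "((\<lambda>t. ln (1 + t) - ln 2) has_real_derivative 1 / (1 + t)) (at t)"
    using assms by (auto intro!: derivative_eq_intros)
  have 2: "((\<lambda>t. 1 - sq_pos (ln (1 + t) - ln 2) / 64) has_real_derivative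
      - (2 * max 0 (ln (1 + t) - ln 2) * (1 / (1 + t)) / 64)) (at t)"
    by (rule DERIV_cong[OF DERIV_diff[OF DERIV_const
          DERIV_cdivide[OF DERIV_chain2[OF has_real_derivative_sq_pos 1]]]]) simp
  show ?thesis
    unfolding cutoff_def[abs_def]
    by (rule DERIV_cong[OF DERIV_chain2[OF has_real_derivative_sq_pos 2]])
      (use assms in \<open>simp add: cutoff'_def field_simps\<close>)
qed

lemma cutoff_bounds: "0 \<le> cutoff t" "cutoff t \<le> 1"
proof -
  show "0 \<le> cutoff t" by (simp add: cutoff_def sq_pos_def)
  have "0 \<le> sq_pos (ln (1 + t) - ln 2)" by (simp add: sq_pos_def)
  then have "(max 0 (1 - sq_pos (ln (1 + t) - ln 2) / 64))\<^sup>2 \<le> 1\<^sup>2"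
    by (intro power_mono) auto
  then show "cutoff t \<le> 1" by (simp add: cutoff_def sq_pos_def[of "1 - _"])
qed

lemma cutoff_eq_1:
  assumes "0 \<le> t" "t \<le> 1"
  shows "cutoff t = 1"
  using assms by (simp add: cutoff_def sq_pos_def max_def)

lemma cutoff_less_1:
  assumes "1 < t"
  shows "cutoff t < 1"
proof -
  have "0 < sq_pos (ln (1 + t) - ln 2)" using assms by (simp add: sq_pos_def)
  then have "(max 0 (1 - sq_pos (ln (1 + t) - ln 2) / 64))\<^sup>2 < 1\<^sup>2"
    by (intro power_strict_mono) auto
  then show ?thesis by (simp add: cutoff_def sq_pos_def[of "1 - _"])
qed

lemma cutoff_eq_0:
  assumes "2 * exp 8 \<le> t"
  shows "cutoff t = 0"
proof -
  \<comment> \<open>A logarithmic excess of 8 is where the inner quotient reaches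
    \<open>8^2 / 64 = 1\<close>.\<close>
  have "ln (2 * exp 8) \<le> ln (1 + t)" using assms by (intro ln_mono) auto
  then have "8 \<le> ln (1 + t) - ln 2" by (simp add: ln_mult)
  then have "8\<^sup>2 \<le> sq_pos (ln (1 + t) - ln 2)" unfolding sq_pos_def by (intro power_mono) auto
  then show ?thesis by (simp add: cutoff_def sq_pos_def[of "1 - _"] max_def)
qed

text \<open>The factor \<open>X\<close> is at most 1 and vanishes once \<open>y\<close> reaches 8,
  so \<open>X * y \<le> 8\<close>; the denominator \<open>16 * (1 + t)\<close> then leaves at most
  \<open>1 / 2\<close> after multiplication by \<open>t\<close>.\<close>

lemma cutoff'_bounds:
  assumes "0 \<le> t"
  shows "cutoff' t \<le> 0" "- 1 / 2 \<le> cutoff' t * t"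
proof -
  define y where "y = max 0 (ln (1 + t) - ln 2)"
  define X where "X = max 0 (1 - y\<^sup>2 / 64)"
  have c': "cutoff' t = - (X * y / (16 * (1 + t)))"
    by (simp add: cutoff'_def X_def y_def sq_pos_def)
  have "0 \<le> y" "0 \<le> X" "X \<le> 1" by (auto simp: y_def X_def)
  then show "cutoff' t \<le> 0" using assms by (simp add: c')
  have "X * y \<le> 8"
  proof (cases "y \<le> 8")
    case True
    then show ?thesis using \<open>X \<le> 1\<close> \<open>0 \<le> y\<close> mult_mono[of X 1 y 8] by simp
  next
    case False
    then have "8\<^sup>2 \<le> y\<^sup>2" by (intro power_mono) auto
    then show ?thesis by (simp add: X_def max_def)
  qed
  have "X * y * t \<le> 8 * t" using \<open>X * y \<le> 8\<close> assms by (rule mult_right_mono)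
  then have "X * y * t \<le> 8 * (1 + t)" by simp
  then show "- 1 / 2 \<le> cutoff' t * t" using assms by (simp add: c' field_simps)
qed

text \<open>Feeding the squared distance to the cutoff keeps the map differentiable at
  \<open>a\<close> itself.\<close>

definition radial_cut :: "real \<Rightarrow> 'a::real_inner \<Rightarrow> 'a \<Rightarrow> 'a" where
  "radial_cut s a v = a + cutoff ((v - a) \<bullet> (v - a) / s) *\<^sub>R (v - a)"

definition radial_cut' :: "real \<Rightarrow> 'a::real_inner \<Rightarrow> 'a \<Rightarrow> 'a \<Rightarrow> 'a" where
  "radial_cut' s a v h = cutoff ((v - a) \<bullet> (v - a) / s) *\<^sub>R h
     + (2 * (cutoff' ((v - a) \<bullet> (v - a) / s) / s) * ((v - a) \<bullet> h)) *\<^sub>R (v - a)"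

lemma has_derivative_radial_cut:
  assumes "0 < s"
  shows "(radial_cut s a has_derivative radial_cut' s a v) (at v)"
proof -
  have 1: "((\<lambda>v. (v - a) \<bullet> (v - a) / s) has_derivative (\<lambda>h. 2 * ((v - a) \<bullet> h) / s)) (at v)"
    using assms by (auto intro!: derivative_eq_intros simp: inner_commute)
  have "(cutoff has_derivative (\<lambda>h. cutoff' ((v - a) \<bullet> (v - a) / s) * h)) (at ((v - a) \<bullet> (v - a) / s))"
    using has_real_derivative_cutoff[of "(v - a) \<bullet> (v - a) / s"] assms
    by (simp add: has_field_derivative_def)
  from has_derivative_compose[OF 1 this]
  have 2: "((\<lambda>v. cutoff ((v - a) \<bullet> (v - a) / s)) has_derivative
      (\<lambda>h. cutoff' ((v - a) \<bullet> (v - a) / s) * (2 * ((v - a) \<bullet> h) / s))) (at v)" .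
  have 3: "((\<lambda>v. v - a) has_derivative (\<lambda>h. h)) (at v)"
    by (auto intro!: derivative_eq_intros)
  have "((\<lambda>v. a + cutoff ((v - a) \<bullet> (v - a) / s) *\<^sub>R (v - a)) has_derivative
     (\<lambda>h. 0 + (cutoff ((v - a) \<bullet> (v - a) / s) *\<^sub>R h
       + (cutoff' ((v - a) \<bullet> (v - a) / s) * (2 * ((v - a) \<bullet> h) / s)) *\<^sub>R (v - a)))) (at v)"
    by (intro has_derivative_add has_derivative_const has_derivative_scaleR 2 3)
  then show ?thesis
    unfolding radial_cut_def[abs_def] radial_cut'_def[abs_def] by (simp add: algebra_simps)
qed

lemma continuous_on_cutoff:
  assumes "continuous_on S f" "\<And>x. x \<in> S \<Longrightarrow> 0 \<le> f x"
  shows "continuous_on S (\<lambda>x. cutoff (f x))" "continuous_on S (\<lambda>x. cutoff' (f x))"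
proof -
  have ln: "continuous_on S (\<lambda>x. ln (1 + f x))"
    using assms by (intro continuous_intros) (auto simp: add_nonneg_eq_0_iff)
  show "continuous_on S (\<lambda>x. cutoff (f x))"
    unfolding cutoff_def by (intro continuous_intros ln) auto
  show "continuous_on S (\<lambda>x. cutoff' (f x))"
    unfolding cutoff'_def using assms(2)
    by (intro continuous_intros ln assms(1)) (auto simp: add_nonneg_eq_0_iff)
qed

lemma continuous_on_radial_cut':
  assumes "0 < s" "continuous_on S f" "continuous_on S g"
  shows "continuous_on S (\<lambda>x. radial_cut' s a (f x) (g x))"
  unfolding radial_cut'_def using assms
  by (intro continuous_intros continuous_on_cutoff) auto

text \<open>The map in \<open>h\<close> is symmetric, with eigenvalue \<open>\<beta>\<close>
  orthogonally to \<open>w\<close> and \<open>\<beta> + 2 * b * (w \<bullet> w)\<close> along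
  \<open>w\<close>; the hypotheses put both in the interval from -1 to 1. The proof expands the
  square and splits on the sign of the coefficient of \<open>c\<close>.\<close>

lemma norm_scaled_plus_rank_one_le:
  fixes w h :: "'a::real_inner"
  assumes \<beta>: "0 \<le> \<beta>" "\<beta> \<le> 1" and b: "b \<le> 0" "- 1 / 2 \<le> b * (w \<bullet> w)"
  shows "norm (\<beta> *\<^sub>R h + (2 * b * (w \<bullet> h)) *\<^sub>R w) \<le> norm h"
proof -
  define S where "S = w \<bullet> w"
  define H where "H = h \<bullet> h"
  define c where "c = (w \<bullet> h)\<^sup>2"
  have "0 \<le> S" "0 \<le> H" "0 \<le> c" by (auto simp: S_def H_def c_def)
  have cS: "c \<le> S * H" unfolding c_def S_def H_def by (rule Cauchy_Schwarz_ineq)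
  have "b * S \<le> 0" using b \<open>0 \<le> S\<close> by (simp add: mult_nonpos_nonneg)
  have "(norm (\<beta> *\<^sub>R h + (2 * b * (w \<bullet> h)) *\<^sub>R w))\<^sup>2 = \<beta>\<^sup>2 * H + 4 * b * (\<beta> + b * S) * c"
    unfolding power2_norm_eq_inner S_def H_def c_def
    by (simp add: inner_add_left inner_add_right inner_commute power2_eq_square algebra_simps)
  also have "\<dots> \<le> H"
  proof (cases "0 \<le> \<beta> + b * S")
    case True
    then have "4 * b * (\<beta> + b * S) * c \<le> 0"
      using b(1) \<open>0 \<le> c\<close> by (simp add: mult_nonneg_nonneg mult_nonpos_nonneg)
    moreover have "\<beta>\<^sup>2 * H \<le> H"
      using \<beta> \<open>0 \<le> H\<close> by (simp add: mult_left_le_one_le power_le_one)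
    ultimately show ?thesis by linarith
  next
    case False
    \<comment> \<open>The coefficient of \<open>c\<close> is now nonnegative, so Cauchy-Schwarz
      replaces \<open>c\<close> by \<open>S * H\<close>, which completes the square of the
      eigenvalue along \<open>w\<close>.\<close>
    then have "0 \<le> 4 * b * (\<beta> + b * S)" using b(1) by (simp add: mult_nonpos_nonpos)
    then have "4 * b * (\<beta> + b * S) * c \<le> 4 * b * (\<beta> + b * S) * (S * H)"
      using cS by (rule mult_left_mono[rotated])
    then have "\<beta>\<^sup>2 * H + 4 * b * (\<beta> + b * S) * c \<le> (\<beta> + 2 * (b * S))\<^sup>2 * H"
      by (simp add: power2_eq_square algebra_simps)
    also have "\<dots> \<le> 1 * H"
    proof (rule mult_right_mono)
      have "\<bar>\<beta> + 2 * (b * S)\<bar> \<le> 1" using \<beta> b(2) \<open>b * S \<le> 0\<close> by (simp add: S_def[symmetric])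
      then show "(\<beta> + 2 * (b * S))\<^sup>2 \<le> 1" by (simp add: abs_square_le_1)
    qed (rule \<open>0 \<le> H\<close>)
    finally show ?thesis by simp
  qed
  also have "H = (norm h)\<^sup>2" by (simp add: H_def power2_norm_eq_inner)
  finally show ?thesis by (rule power2_le_imp_le) simp
qed

lemma norm_radial_cut'_le:
  assumes "0 < s"
  shows "norm (radial_cut' s a v h) \<le> norm h"
  unfolding radial_cut'_def
  using cutoff'_bounds[of "(v - a) \<bullet> (v - a) / s"] assms
  by (intro norm_scaled_plus_rank_one_le cutoff_bounds) (simp_all add: divide_nonpos_pos)

lemma radial_cut_near:
  assumes "0 < s" "(norm (v - a))\<^sup>2 \<le> s"
  shows "radial_cut s a v = v"
  using assms cutoff_eq_1[of "(v - a) \<bullet> (v - a) / s"]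
  by (simp add: radial_cut_def power2_norm_eq_inner)

section \<open>Decrease of the potential and comparison of energies\<close>

lemma strict_mono_on_ray_less:
  fixes W :: "'a::real_normed_vector \<Rightarrow> real"
  assumes W: "\<And>v. 0 \<le> W v" "W a = 0"
    and mono: "\<And>\<nu>. norm \<nu> = 1 \<Longrightarrow> strict_mono_on {0<..<r0} (\<lambda>r. W (a + r *\<^sub>R \<nu>))"
    and v: "0 < norm (v - a)" "norm (v - a) < r0" and \<beta>: "0 \<le> \<beta>" "\<beta> < 1"
  shows "W (a + \<beta> *\<^sub>R (v - a)) < W v"
proof -
  define \<rho> where "\<rho> = norm (v - a)"
  define \<nu> where "\<nu> = (v - a) /\<^sub>R \<rho>"
  have \<rho>: "0 < \<rho>" "\<rho> < r0" using v by (auto simp: \<rho>_def)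
  have "norm \<nu> = 1" using \<rho>(1) by (simp add: \<nu>_def \<rho>_def)
  have v_eq: "v - a = \<rho> *\<^sub>R \<nu>" using \<rho>(1) by (simp add: \<nu>_def)
  have less: "W (a + (\<gamma> * \<rho>) *\<^sub>R \<nu>) < W v" if "0 < \<gamma>" "\<gamma> < 1" for \<gamma>
  proof -
    have "\<gamma> * \<rho> < \<rho>" using that \<rho>(1) by simp
    then have "W (a + (\<gamma> * \<rho>) *\<^sub>R \<nu>) < W (a + \<rho> *\<^sub>R \<nu>)"
      using strict_mono_onD[OF mono[OF \<open>norm \<nu> = 1\<close>], of "\<gamma> * \<rho>" \<rho>] that \<rho> by simp
    then show ?thesis by (simp add: v_eq[symmetric])
  qed
  show ?thesis
  proof (cases "\<beta> = 0")
    \<comment> \<open>Monotonicity is given on an open interval without the endpoint 0, so the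
      midpoint of the ray supplies \<open>0 \<le> W (...) < W v\<close>.\<close>
    case True
    then show ?thesis using less[of "1/2"] W order_le_less_trans[OF W(1)] by simp
  next
    case False
    then show ?thesis using less[of \<beta>] \<beta> by (simp add: v_eq)
  qed
qed

text \<open>Three zones: up to squared distance \<open>s\<close> nothing moves; beyond that but
  within \<open>r0\<close> points slide strictly inwards along their ray; from \<open>r0\<close> on,
  the condition \<open>2 * exp 8 * s \<le> r0\<^sup>2\<close> sends everything to the zero
  \<open>a\<close>.\<close>

lemma potential_radial_cut:
  fixes W :: "'a::real_inner \<Rightarrow> real"
  assumes W: "\<And>v. 0 \<le> W v" "W a = 0"
    and mono: "\<And>\<nu>. norm \<nu> = 1 \<Longrightarrow> strict_mono_on {0<..<r0} (\<lambda>r. W (a + r *\<^sub>R \<nu>))"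
    and s: "0 < s" "2 * exp 8 * s \<le> r0\<^sup>2" and r0: "0 < r0"
  shows "W (radial_cut s a v) \<le> W v"
    and "s < (norm (v - a))\<^sup>2 \<Longrightarrow> norm (v - a) < r0 \<Longrightarrow> W (radial_cut s a v) < W v"
proof -
  define t where "t = (v - a) \<bullet> (v - a) / s"
  have R: "radial_cut s a v = a + cutoff t *\<^sub>R (v - a)" by (simp add: radial_cut_def t_def)
  have t: "t = (norm (v - a))\<^sup>2 / s" by (simp add: t_def power2_norm_eq_inner)
  have less: "W (radial_cut s a v) < W v" if "1 < t" "norm (v - a) < r0"
  proof -
    have "0 < norm (v - a)" using that(1) s(1) by (auto simp: t)
    then show ?thesis
      unfolding R using that cutoff_less_1[OF that(1)] cutoff_bounds
      by (intro strict_mono_on_ray_less[OF W mono])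
  qed
  then show "W (radial_cut s a v) < W v" if "s < (norm (v - a))\<^sup>2" "norm (v - a) < r0"
    using that s(1) by (simp add: t)
  show "W (radial_cut s a v) \<le> W v"
  proof (cases "t \<le> 1")
    case True
    then show ?thesis using radial_cut_near[of s v a] s(1) by (simp add: t)
  next
    case False
    show ?thesis
    proof (cases "norm (v - a) < r0")
      case True
      with less False show ?thesis by simp
    next
      case False
      then have "r0\<^sup>2 \<le> (norm (v - a))\<^sup>2" using r0 by (intro power_mono) auto
      then have "2 * exp 8 \<le> t" using s by (simp add: t field_simps)
      then show ?thesis using W by (simp add: R cutoff_eq_0)
    qed
  qed
qed

lemma minimizer_dist_le:
  fixes W :: "real^'m \<Rightarrow> real" and u :: "real^'n \<Rightarrow> real^'m"
    and Du :: "real^'n \<Rightarrow> ((real^'n) \<Rightarrow>\<^sub>L (real^'m))"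
  assumes contW: "continuous_on UNIV W" and W: "\<And>v. 0 \<le> W v" "W a = 0"
    and mono: "\<And>\<nu>. norm \<nu> = 1 \<Longrightarrow> strict_mono_on {0<..<r0} (\<lambda>r. W (a + r *\<^sub>R \<nu>))"
    and r0: "0 < r0" and s: "0 < s" "2 * exp 8 * s \<le> r0\<^sup>2"
    and u: "\<And>x. (u has_derivative blinfun_apply (Du x)) (at x)" and Du: "continuous_on UNIV Du"
    and min: "globally_minimizing W u Du" and lim: "(u \<longlongrightarrow> a) at_infinity"
  shows "(norm (u x - a))\<^sup>2 \<le> s"
proof -
  have contu: "continuous_on UNIV u"
    by (rule has_derivative_continuous_on) (rule u)
  have "\<forall>\<^sub>F x in at_infinity. dist (u x) a < sqrt s" using lim s(1) by (intro tendstoD) auto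
  then obtain R0 where R0: "\<And>x. R0 \<le> norm x \<Longrightarrow> norm (u x - a) < sqrt s"
    by (auto simp: eventually_at_infinity dist_norm)
  have near: "(norm (u x - a))\<^sup>2 \<le> s" if "R0 \<le> norm x" for x
    using power_mono[OF less_imp_le[OF R0[OF that]], of 2] s(1) by simp
  \<comment> \<open>The factor \<open>CARD('n)\<close> compares the \<open>l1\<close> and Euclidean
    norms, so points outside \<open>\<Omega>\<close> have norm at least \<open>R0\<close>; the
    maximum with 1 keeps the radius positive.\<close>
  define \<Omega> :: "(real^'n) set" where "\<Omega> = cross_polytope (real CARD('n) * max 1 R0)"
  have \<Omega>: "open \<Omega>" "bounded \<Omega>" "lipschitz_boundary \<Omega>"
    unfolding \<Omega>_def
    by (auto intro!: open_cross_polytope bounded_cross_polytope lipschitz_boundary_cross_polytope mult_pos_pos)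
  have out: "(norm (u x - a))\<^sup>2 \<le> s" if "x \<notin> \<Omega>" for x
    using norm_ge_outside_cross_polytope[OF that[unfolded \<Omega>_def]] by (intro near) simp
  \<comment> \<open>The competitor \<open>u + \<phi>\<close> is the cut-off map applied to
    \<open>u\<close>; outside \<open>\<Omega>\<close> it agrees with \<open>u\<close>, whose values
    lie where the cut is the identity.\<close>
  define \<phi> where "\<phi> x = radial_cut s a (u x) - u x" for x
  define G where "G x = (\<chi> j. radial_cut' s a (u x) (Du x (axis j 1)) - Du x (axis j 1))" for x
  have "H10 \<Omega> \<phi> G"
  proof (rule H10_of_C1)
    show "(\<phi> has_derivative (\<lambda>h. radial_cut' s a (u x) (Du x h) - Du x h)) (at x)" for x
      unfolding \<phi>_def
      by (intro has_derivative_diff u has_derivative_compose[OF u has_derivative_radial_cut[OF s(1)]])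
    show "G x $ j = radial_cut' s a (u x) (Du x (axis j 1)) - Du x (axis j 1)" for x j
      by (simp add: G_def)
    show "continuous_on UNIV G"
      unfolding G_def using s(1) by (intro continuous_intros continuous_on_radial_cut' contu Du)
    show "bounded \<Omega>" by (rule \<Omega>)
    show "\<phi> x = 0" if "x \<notin> \<Omega>" for x
      using radial_cut_near[OF s(1) out[OF that]] by (simp add: \<phi>_def)
  qed
  then have "energy W \<Omega> u (grad_mat Du) \<le> energy W \<Omega> (\<lambda>x. u x + \<phi> x) (\<lambda>x. grad_mat Du x + G x)"
    using min \<Omega> by (auto simp: globally_minimizing_def)
  moreover define A where "A x = 1/2 * (\<Sum>j\<in>UNIV. (norm (Du x (axis j 1)))\<^sup>2) + W (u x)" for x
  define B where "B x = 1/2 * (\<Sum>j\<in>UNIV. (norm (radial_cut' s a (u x) (Du x (axis j 1))))\<^sup>2)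
      + W (radial_cut s a (u x))" for x
  have "energy W \<Omega> u (grad_mat Du) = (\<integral>\<^sup>+x\<in>\<Omega>. ennreal (A x) \<partial>lborel)"
    by (simp add: energy_def grad_mat_def A_def)
  moreover have "energy W \<Omega> (\<lambda>x. u x + \<phi> x) (\<lambda>x. grad_mat Du x + G x)
      = (\<integral>\<^sup>+x\<in>\<Omega>. ennreal (B x) \<partial>lborel)"
    by (simp add: energy_def grad_mat_def B_def \<phi>_def G_def)
  ultimately have le: "(\<integral>\<^sup>+x\<in>\<Omega>. ennreal (A x) \<partial>lborel) \<le> (\<integral>\<^sup>+x\<in>\<Omega>. ennreal (B x) \<partial>lborel)"
    by simp
  have contR: "continuous_on UNIV (radial_cut s a)"
    by (rule has_derivative_continuous_on) (rule has_derivative_radial_cut[OF s(1)])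
  have contRu: "continuous_on UNIV (\<lambda>x. radial_cut s a (u x))"
    by (rule continuous_on_compose2[OF contR contu]) simp
  have contA: "continuous_on UNIV A"
    unfolding A_def by (intro continuous_intros continuous_on_compose2[OF contW contu] Du) auto
  have contB: "continuous_on UNIV B"
    unfolding B_def
    by (intro continuous_intros continuous_on_compose2[OF contW contRu] continuous_on_radial_cut' s(1) contu Du) auto
  have grad_le: "(\<Sum>j\<in>UNIV. (norm (radial_cut' s a (u x) (Du x (axis j 1))))\<^sup>2)
      \<le> (\<Sum>j\<in>UNIV. (norm (Du x (axis j 1)))\<^sup>2)" for x
    by (intro sum_mono power_mono norm_radial_cut'_le s(1)) simp
  have W_le: "W (radial_cut s a v) \<le> W v" for v
    by (rule potential_radial_cut(1)[OF W mono s r0])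
  have "0 \<le> B x" for x by (auto simp: B_def W(1) intro!: add_nonneg_nonneg sum_nonneg)
  moreover have "B x \<le> A x" for x
    using grad_le[of x] W_le[of "u x"] by (simp add: A_def B_def)
  ultimately have AB: "A x = B x" if "x \<in> \<Omega>" for x
    using eq_of_set_nn_integral_le[OF contA contB \<Omega>(1,2) _ _ le that] by blast
  \<comment> \<open>Neither the gradient part nor the potential part can grow, so equality of the
    densities forces equality of the potentials, which fails in the open annulus.\<close>
  have gap: "\<not> (s < (norm (u x - a))\<^sup>2 \<and> norm (u x - a) < r0)" for x
  proof (cases "x \<in> \<Omega>")
    case True
    have "W (u x) = W (radial_cut s a (u x))"
      using AB[OF True] grad_le[of x] W_le[of "u x"] by (simp add: A_def B_def)
    with potential_radial_cut(2)[OF W mono s r0, of "u x"] show ?thesis by auto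
  next
    case False
    with out show ?thesis by (meson not_le)
  qed
  show ?thesis
  proof (rule ccontr)
    assume "\<not> (norm (u x - a))\<^sup>2 \<le> s"
    then have "sqrt s < norm (u x - a)"
      by (simp add: real_less_lsqrt not_le real_sqrt_less_iff flip: real_sqrt_abs)
    \<comment> \<open>The annulus of excluded values is nonempty, because
      \<open>s < 2 * exp 8 * s\<close>. The distance to \<open>a\<close> is below
      \<open>sqrt s\<close> far out, so by connectedness it would have to take a value
      \<open>z\<close> inside this gap.\<close>
    moreover have "sqrt s < r0"
    proof -
      have "1 * s < 2 * exp 8 * s" using s(1) one_le_exp_iff[of "8::real"] by (intro mult_strict_right_mono) linarith+
      then have "s < r0\<^sup>2" using s(2) by simp
      then show ?thesis using r0 by (simp add: real_less_lsqrt s(1))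
    qed
    ultimately obtain z where z: "sqrt s < z" "z < r0" "z \<le> norm (u x - a)"
      using dense[of "sqrt s" "min r0 (norm (u x - a))"] by auto
    obtain x1 :: "real^'n" where "norm x1 = \<bar>R0\<bar>" using vector_choose_size[of "\<bar>R0\<bar>"] by auto
    then have x1: "norm (u x1 - a) < sqrt s" by (intro R0) simp
    have "connected (range (\<lambda>x. norm (u x - a)))"
      by (intro connected_continuous_image continuous_intros contu connected_UNIV)
    then have "z \<in> range (\<lambda>x. norm (u x - a))"
      using connectedD_interval[of _ "norm (u x1 - a)" "norm (u x - a)" z] x1 z by auto
    then obtain y where y: "z = norm (u y - a)" by auto
    have "(sqrt s)\<^sup>2 < z\<^sup>2" using z(1) s(1) by (intro power_strict_mono) auto
    then show False using gap[of y] y z s(1) by simp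
  qed
qed

theorem theorem2:
  fixes W :: "real^'m \<Rightarrow> real" and gradW :: "real^'m \<Rightarrow> real^'m"
    and Z :: "(real^'m) set"
    and u :: "real^'n \<Rightarrow> real^'m"
    and Du :: "real^'n \<Rightarrow> ((real^'n) \<Rightarrow>\<^sub>L (real^'m))"
    and D2u :: "real^'n \<Rightarrow> ((real^'n) \<Rightarrow>\<^sub>L ((real^'n) \<Rightarrow>\<^sub>L (real^'m)))"
  assumes n2: "CARD('n) \<ge> 2"
    and W_C1: "\<forall>v. (W has_derivative (\<lambda>h. gradW v \<bullet> h)) (at v)" "continuous_on UNIV gradW"
    and W_nonneg: "\<forall>v. W v \<ge> 0"
    and Z_fin: "finite Z" "Z \<noteq> {}"
    and Z_zero: "\<forall>a\<in>Z. W a = 0"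
    and W_pos: "\<forall>v. v \<notin> Z \<longrightarrow> W v > 0"
    and W_mono: "\<exists>r0>0. \<forall>a\<in>Z. \<forall>\<nu>. norm \<nu> = 1 \<longrightarrow>
                    strict_mono_on {0<..<r0} (\<lambda>r. W (a + r *\<^sub>R \<nu>))"
    and W_inf: "Liminf at_infinity (\<lambda>v. ereal (W v)) > 0"
    and u_C2: "\<forall>x. (u has_derivative blinfun_apply (Du x)) (at x)"
              "\<forall>x. (Du has_derivative blinfun_apply (D2u x)) (at x)"
              "continuous_on UNIV D2u"
    and u_eq: "\<forall>x. laplacian D2u x = gradW (u x)"
    and u_bdd: "bounded (range u)"
    and u_min: "globally_minimizing W u Du"
    and u_fin: "(\<integral>\<^sup>+ x. ennreal (W (u x)) \<partial>lborel) < \<infinity>"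
  shows "\<exists>a\<in>Z. \<forall>x. u x = a"
proof -
  obtain M where M: "\<And>x. norm (u x) \<le> M" using u_bdd by (auto simp: bounded_iff)
  \<comment> \<open>The equation makes the Laplacian bounded, since \<open>gradW\<close> is bounded
    on a ball containing the range of \<open>u\<close>.\<close>
  have "compact (gradW ` cball 0 M)"
    using W_C1(2) by (intro compact_continuous_image) (auto intro: continuous_on_subset)
  then obtain F where F: "\<And>v. v \<in> cball 0 M \<Longrightarrow> norm (gradW v) \<le> F"
    by (meson bounded_iff compact_imp_bounded imageI)
  have "norm (laplacian D2u x) \<le> F" for x using u_eq F[of "u x"] M by simp
  then obtain L where "L-lipschitz_on UNIV u"
    using lipschitz_of_bounded_laplacian[of u Du D2u M F] u_C2 M by metis
  then have unif: "uniformly_continuous_on UNIV u" by (rule lipschitz_on_uniformly_continuous)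
  have contW: "continuous_on UNIV W"
    by (rule has_derivative_continuous_on) (rule W_C1(1)[rule_format])
  have contDu: "continuous_on UNIV Du"
    by (rule has_derivative_continuous_on) (rule u_C2(2)[rule_format])
  obtain a where a: "a \<in> Z" "(u \<longlongrightarrow> a) at_infinity"
  proof (rule tendsto_single_zero_at_infinity[OF _ Z_fin(1) unif u_bdd contW _ u_fin])
    show "2 \<le> DIM(real^'n)" using n2 by simp
  qed (use W_pos in auto)
  obtain r0 where r0: "0 < r0"
    and mono: "\<And>\<nu>. norm \<nu> = 1 \<Longrightarrow> strict_mono_on {0<..<r0} (\<lambda>r. W (a + r *\<^sub>R \<nu>))"
    using W_mono a(1) by blast
  have "u x = a" for x
  proof (rule ccontr)
    assume "u x \<noteq> a"
    \<comment> \<open>The first entry makes \<open>s\<close> admissible for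
      \<open>minimizer_dist_le\<close>; the second keeps \<open>s\<close> strictly below the squared
      distance that the lemma bounds by \<open>s\<close>.\<close>
    define s where "s = min (r0\<^sup>2 / (2 * exp 8)) ((norm (u x - a))\<^sup>2 / 2)"
    have "s \<le> r0\<^sup>2 / (2 * exp 8)" "s \<le> (norm (u x - a))\<^sup>2 / 2" by (auto simp: s_def)
    moreover have "0 < s" using r0 \<open>u x \<noteq> a\<close> by (simp add: s_def)
    ultimately have "(norm (u x - a))\<^sup>2 \<le> s"
      using minimizer_dist_le[OF contW W_nonneg[rule_format] _ mono r0 _ _ u_C2(1)[rule_format]
          contDu u_min a(2)] a(1) Z_zero by (simp add: field_simps)
    with \<open>s \<le> (norm (u x - a))\<^sup>2 / 2\<close> \<open>0 < s\<close> show False by simp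
  qed
  with a(1) show ?thesis by blast
qed

end
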